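(* Assume that the unperturbed system $\dot x=X^0(x)$ on $\mathscr{M}$ has a homoclinic orbit $\gamma^{\mathrm h}(t)$ to a $T$-periodic orbit $\gamma^{\mathrm p}(t)$ (where $\gamma^{\mathrm p}$ may be an equilibrium), and that it has a non-constant $C^3$ first integral $F(x)$ near $\Gamma^{\mathrm h}=\{\gamma^{\mathrm h}(t)\mid t\in\mathbb{R}\}\cup\Gamma^{\mathrm p}$, where $\Gamma^{\mathrm p}=\{\gamma^{\mathrm p}(t)\mid t\in[0,T)\}$. Assume moreover that there exists a periodic orbit $\gamma^{\mathrm p}_\varepsilon$ of the perturbed system $\dot x=X_\varepsilon(x)$ depending $C^2$-smoothly on $\varepsilon$ such that $\gamma^{\mathrm p}_0=\gamma^{\mathrm p}$. If the perturbed system has a homoclinic orbit $\gamma^{\mathrm h}_\varepsilon$ to $\gamma^{\mathrm p}_\varepsilon$ depending $C^2$-smoothly on $\varepsilon$ such that $\gamma^{\mathrm h}_0=\gamma^{\mathrm h}$, then the limit $$\tilde{\mathscr{I}}_{F,\gamma^{\mathrm h}}:=\lim_{k\to+\infty}\int_{T_{-k}}^{T_k}dF(X^1)(\gamma^{\mathrm h}(t))\,dt$$ exists and $\tilde{\mathscr{I}}_{F,\gamma^{\mathrm h}}=0$, where $\{T_j\}_{j\in\mathbb{Z}}$ is the time sequence described in the context.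
   Context: $\mathscr{M}$ is an $n$-dimensional ($n\ge 2$) paracompact oriented $C^3$ real manifold. $\varepsilon$ is a small parameter, $0\le\varepsilon\ll 1$, and $X_\varepsilon$ is a family of vector fields on $\mathscr{M}$ that is $C^2$ with respect to $x$ and $\varepsilon$, with $X_\varepsilon(x)=X^0(x)+\varepsilon X^1(x)+O(\varepsilon^2)$. A first integral $F$ of $X^0$ satisfies $dF(X^0)=0$. Time sequence. If $\gamma^{\mathrm p}$ is not an equilibrium, let $x_0=\gamma^{\mathrm p}(0)$ and let $\Sigma$ be an $(n-1)$-dimensional hypersurface (Poincaré section) which $\gamma^{\mathrm p}$ intersects transversely at $x_0$, restricted to a sufficiently small neighborhood of $x_0$, so that $\gamma^{\mathrm h}(t)$ intersects $\Sigma$ transversely infinitely many times, at the times $T_j\in\mathbb{R}$, $T_{j-1}<T_j$, $j\in\mathbb{Z}$, with $\lim_{j\to\pm\infty}T_j=\pm\infty$; in particular $\lim_{j\to\pm\infty}\gamma^{\mathrm h}(T_j)=x_0$. If $\gamma^{\mathrm p}$ is an equilibrium, $\{T_j\}_{j\in\mathbb{Z}}$ is any sequence (strictly increasing) with $\lim_{j\to\pm\infty}T_j=\pm\infty$, and $\tilde{\mathscr{I}}_{F,\gamma^{\mathrm h}}=\int_{-\infty}^{\infty}dF(X^1)(\gamma^{\mathrm h}(t))\,dt$. If $\gamma^{\mathrm p}$ is an equilibrium, $\gamma^{\mathrm p}_\varepsilon$ is likewise an equilibrium.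
   Formalization: "Depending C²-smoothly on ε" for the homoclinic orbit is taken to include bounds on its first two ε-derivatives, uniform in time along the whole orbit up to a C² change of time; with smoothness only locally uniform in t the claim fails (bottleneck near a degenerate equilibrium). *)

theory Defs
  imports "HOL-Analysis.Analysis" "HOL-Library.Landau_Symbols"
begin

section \<open>Finitely often differentiable maps\<close>

text \<open>
  The one-sided derivatives \<open>at x within S\<close> are intended: the parameter ranges over a half-open
  interval \<open>[0, \<epsilon>\<^sub>0)\<close>. On the sets used below (relatively open subsets of a Euclidean space or of
  its product with such an interval) these derivatives are unique. As the source is
  finite-dimensional, continuity of a derivative may be tested in every fixed direction \<open>v\<close>.
\<close>

primrec Ck_on :: "nat \<Rightarrow> ('a::euclidean_space \<Rightarrow> 'b::real_normed_vector) \<Rightarrow> 'a set \<Rightarrow> bool" where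
  "Ck_on 0 f S \<longleftrightarrow> continuous_on S f"
| "Ck_on (Suc k) f S \<longleftrightarrow>
     (\<exists>f'. (\<forall>x\<in>S. (f has_derivative f' x) (at x within S)) \<and> (\<forall>v. Ck_on k (\<lambda>x. f' x v) S))"


section \<open>Manifolds\<close>

definition paracompact_space :: "'a topology \<Rightarrow> bool" where
  "paracompact_space X \<longleftrightarrow>
     (\<forall>\<U>. (\<forall>U\<in>\<U>. openin X U) \<and> \<Union>\<U> = topspace X \<longrightarrow>
        (\<exists>\<V>. (\<forall>V\<in>\<V>. openin X V \<and> (\<exists>U\<in>\<U>. V \<subseteq> U)) \<and> \<Union>\<V> = topspace X \<and>
             locally_finite_in X \<V>))"

text \<open>A chart is a pair of its domain and its coordinate map.\<close>

type_synonym ('m, 'n) chart = "'m set \<times> ('m \<Rightarrow> real ^ 'n)"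

abbreviation chart_inv :: "('m, 'n::finite) chart \<Rightarrow> real ^ 'n \<Rightarrow> 'm" where
  "chart_inv c \<equiv> inv_into (fst c) (snd c)"

abbreviation transition :: "('m, 'n::finite) chart \<Rightarrow> ('m, 'n) chart \<Rightarrow> real ^ 'n \<Rightarrow> real ^ 'n" where
  "transition c c' \<equiv> snd c' \<circ> chart_inv c"

text \<open>
  The manifold is the whole type \<open>'m\<close> (Hausdorff by its class), its dimension is \<open>CARD('n)\<close>, and
  its oriented \<open>C\<^sup>3\<close> structure is the one generated by the atlas \<open>A\<close>.
\<close>

definition oriented_C3_manifold :: "('m::t2_space, 'n::finite) chart set \<Rightarrow> bool" where
  "oriented_C3_manifold A \<longleftrightarrow>
     paracompact_space (euclidean :: 'm topology) \<and>
     (\<Union>c\<in>A. fst c) = UNIV \<and>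
     (\<forall>c\<in>A. open (fst c) \<and> open (snd c ` fst c) \<and>
            homeomorphism (fst c) (snd c ` fst c) (snd c) (chart_inv c)) \<and>
     (\<forall>c\<in>A. \<forall>c'\<in>A.
        Ck_on 3 (transition c c') (snd c ` (fst c \<inter> fst c')) \<and>
        (\<forall>u\<in>snd c ` (fst c \<inter> fst c').
           det (matrix (frechet_derivative (transition c c') (at u))) > 0))"

definition Ck_function ::
    "('m, 'n::finite) chart set \<Rightarrow> nat \<Rightarrow> 'm set \<Rightarrow> ('m \<Rightarrow> real) \<Rightarrow> bool" where
  "Ck_function A k W F \<longleftrightarrow> (\<forall>c\<in>A. Ck_on k (F \<circ> chart_inv c) (snd c ` (fst c \<inter> W)))"

definition Ck_into ::
    "('m::t2_space, 'n::finite) chart set \<Rightarrow> nat \<Rightarrow> 'a::euclidean_space set \<Rightarrow> ('a \<Rightarrow> 'm) \<Rightarrow> bool" where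
  "Ck_into A k S f \<longleftrightarrow>
     continuous_on S f \<and> (\<forall>c\<in>A. Ck_on k (snd c \<circ> f) {x\<in>S. f x \<in> fst c})"


section \<open>Vector fields and differentials\<close>

text \<open>
  A tangent vector is given by its coordinates in all charts around its base point, subject to the
  usual transformation rule. Thus \<open>X c p\<close> is the coordinate vector of the field \<open>X\<close> at \<open>p\<close> in the
  chart \<open>c\<close>; it is irrelevant if \<open>c\<close> is not in the atlas or \<open>p\<close> is not in the domain of \<open>c\<close>.
\<close>

type_synonym ('m, 'n) field = "('m, 'n) chart \<Rightarrow> 'm \<Rightarrow> real ^ 'n"

definition vector_field :: "('m, 'n::finite) chart set \<Rightarrow> ('m, 'n) field \<Rightarrow> bool" where
  "vector_field A X \<longleftrightarrow>
     (\<forall>c\<in>A. \<forall>c'\<in>A. \<forall>p\<in>fst c \<inter> fst c'.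
        X c' p = frechet_derivative (transition c c') (at (snd c p)) (X c p))"

text \<open>
  The function \<open>dF(X)\<close>. By the transformation rule the value at \<open>p\<close> does not depend on the chosen
  chart around \<open>p\<close>.
\<close>

definition d_along ::
    "('m, 'n::finite) chart set \<Rightarrow> ('m \<Rightarrow> real) \<Rightarrow> ('m, 'n) field \<Rightarrow> 'm \<Rightarrow> real" where
  "d_along A F X p =
     (let c = (SOME c. c \<in> A \<and> p \<in> fst c)
      in frechet_derivative (F \<circ> chart_inv c) (at (snd c p)) (X c p))"

definition C2_field_family ::
    "('m, 'n::finite) chart set \<Rightarrow> real \<Rightarrow> (real \<Rightarrow> ('m, 'n) field) \<Rightarrow> bool" where
  "C2_field_family A \<epsilon>0 X \<longleftrightarrow>
     (\<forall>\<epsilon>\<in>{0..<\<epsilon>0}. vector_field A (X \<epsilon>)) \<and>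
     (\<forall>c\<in>A. Ck_on 2 (\<lambda>(u, \<epsilon>). X \<epsilon> c (chart_inv c u)) ((snd c ` fst c) \<times> {0..<\<epsilon>0}))"

definition first_order_expansion ::
    "('m, 'n::finite) chart set \<Rightarrow> (real \<Rightarrow> ('m, 'n) field) \<Rightarrow> ('m, 'n) field \<Rightarrow> ('m, 'n) field \<Rightarrow> bool"
    where
  "first_order_expansion A X X0 X1 \<longleftrightarrow>
     vector_field A X0 \<and> vector_field A X1 \<and>
     (\<forall>c\<in>A. \<forall>p\<in>fst c.
        (\<lambda>\<epsilon>. norm (X \<epsilon> c p - (X0 c p + \<epsilon> *\<^sub>R X1 c p))) \<in> O[at_right 0](\<lambda>\<epsilon>. \<epsilon>\<^sup>2))"

definition first_integral_on ::
    "('m, 'n::finite) chart set \<Rightarrow> ('m, 'n) field \<Rightarrow> 'm set \<Rightarrow> ('m \<Rightarrow> real) \<Rightarrow> bool" where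
  "first_integral_on A X W F \<longleftrightarrow> (\<forall>p\<in>W. d_along A F X p = 0)"


section \<open>Orbits\<close>

definition integral_curve ::
    "('m::t2_space, 'n::finite) chart set \<Rightarrow> ('m, 'n) field \<Rightarrow> (real \<Rightarrow> 'm) \<Rightarrow> bool" where
  "integral_curve A X \<gamma> \<longleftrightarrow>
     continuous_on UNIV \<gamma> \<and>
     (\<forall>t. \<forall>c\<in>A. \<gamma> t \<in> fst c \<longrightarrow> ((snd c \<circ> \<gamma>) has_vector_derivative X c (\<gamma> t)) (at t))"

text \<open>Equilibria (constant solutions) count as \<open>T\<close>-periodic orbits for every \<open>T > 0\<close>.\<close>

definition periodic_orbit ::
    "('m::t2_space, 'n::finite) chart set \<Rightarrow> ('m, 'n) field \<Rightarrow> real \<Rightarrow> (real \<Rightarrow> 'm) \<Rightarrow> bool" where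
  "periodic_orbit A X T \<gamma> \<longleftrightarrow> integral_curve A X \<gamma> \<and> T > 0 \<and> (\<forall>t. \<gamma> (t + T) = \<gamma> t)"

definition equilibrium_orbit :: "(real \<Rightarrow> 'm) \<Rightarrow> bool" where
  "equilibrium_orbit \<gamma> \<longleftrightarrow> (\<forall>t. \<gamma> t = \<gamma> 0)"

text \<open>
  Since a periodic orbit \<open>\<Gamma>\<close> is compact, being eventually in every neighbourhood of \<open>\<Gamma>\<close> is
  convergence of the distance to \<open>\<Gamma>\<close> to zero, for any metric inducing the topology.
\<close>

definition homoclinic_orbit ::
    "('m::t2_space, 'n::finite) chart set \<Rightarrow> ('m, 'n) field \<Rightarrow> (real \<Rightarrow> 'm) \<Rightarrow> 'm set \<Rightarrow> bool" where
  "homoclinic_orbit A X \<gamma> \<Gamma> \<longleftrightarrow>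
     integral_curve A X \<gamma> \<and> (\<forall>t. \<gamma> t \<notin> \<Gamma>) \<and>
     (\<forall>V. open V \<and> \<Gamma> \<subseteq> V \<longrightarrow>
        eventually (\<lambda>t. \<gamma> t \<in> V) at_top \<and> eventually (\<lambda>t. \<gamma> t \<in> V) at_bot)"


section \<open>Smooth dependence of orbits on the parameter\<close>

text \<open>Families of curves are written \<open>\<gamma> \<epsilon> t\<close>, with \<open>\<epsilon>\<close> ranging over \<open>[0, \<epsilon>0)\<close>.\<close>

definition C2_curve_family ::
    "('m::t2_space, 'n::finite) chart set \<Rightarrow> real \<Rightarrow> (real \<Rightarrow> real \<Rightarrow> 'm) \<Rightarrow> bool" where
  "C2_curve_family A \<epsilon>0 \<gamma> \<longleftrightarrow> Ck_into A 2 ({0..<\<epsilon>0} \<times> UNIV) (\<lambda>(\<epsilon>, t). \<gamma> \<epsilon> t)"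

definition C2_periodic_family ::
    "('m::t2_space, 'n::finite) chart set \<Rightarrow> real \<Rightarrow> (real \<Rightarrow> real) \<Rightarrow> (real \<Rightarrow> real \<Rightarrow> 'm) \<Rightarrow> bool" where
  "C2_periodic_family A \<epsilon>0 P \<gamma> \<longleftrightarrow> C2_curve_family A \<epsilon>0 \<gamma> \<and> Ck_on 2 P {0..<\<epsilon>0}"

text \<open>
  The first two \<open>\<epsilon>\<close>-derivatives of \<open>\<Phi> \<epsilon> s\<close> near \<open>\<epsilon> = 0\<close> are bounded uniformly in \<open>s \<in> \<real>\<close>. On a
  manifold this is expressed in every chart, over compact subsets of its domain.
\<close>

definition uniform_C2_bounds ::
    "('m::t2_space, 'n::finite) chart set \<Rightarrow> real \<Rightarrow> (real \<Rightarrow> real \<Rightarrow> 'm) \<Rightarrow> bool" where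
  "uniform_C2_bounds A \<epsilon>0 \<Phi> \<longleftrightarrow>
     (\<forall>c\<in>A. \<forall>K. compact K \<and> K \<subseteq> fst c \<longrightarrow>
        (\<exists>\<delta> B. 0 < \<delta> \<and> \<delta> \<le> \<epsilon>0 \<and>
           (\<forall>s. \<Phi> 0 s \<in> K \<longrightarrow>
              (\<exists>D1 D2. \<forall>\<epsilon>\<in>{0..<\<delta>}.
                 \<Phi> \<epsilon> s \<in> fst c \<and>
                 ((\<lambda>e. snd c (\<Phi> e s)) has_vector_derivative D1 \<epsilon>) (at \<epsilon> within {0..<\<delta>}) \<and>
                 (D1 has_vector_derivative D2 \<epsilon>) (at \<epsilon> within {0..<\<delta>}) \<and>
                 norm (D1 \<epsilon>) \<le> B \<and> norm (D2 \<epsilon>) \<le> B))))"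

text \<open>
  A homoclinic orbit is a curve over the non-compact line, and its \<open>C\<^sup>2\<close> dependence on \<open>\<epsilon>\<close> is
  understood along the whole orbit, not only locally uniformly in time: with the latter, weaker
  notion a degenerate equilibrium near which the perturbed flow passes a bottleneck can produce a
  jump of size proportional to \<open>\<epsilon>\<close> at times tending to infinity as \<open>\<epsilon> \<rightarrow> 0\<close>. A change of time
  \<open>\<tau> \<epsilon>\<close> is admitted, since the period of the limiting periodic orbit may vary with \<open>\<epsilon>\<close>, in which
  case \<open>\<epsilon>\<close>-derivatives at a fixed time \<open>t\<close> grow with \<open>t\<close>; the typical choice is
  \<open>\<tau> \<epsilon> s = (P \<epsilon> / P 0) * s\<close>, where \<open>P \<epsilon>\<close> is the period.
\<close>

definition C2_homoclinic_family ::
    "('m::t2_space, 'n::finite) chart set \<Rightarrow> real \<Rightarrow> (real \<Rightarrow> real \<Rightarrow> 'm) \<Rightarrow> bool" where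
  "C2_homoclinic_family A \<epsilon>0 \<gamma> \<longleftrightarrow>
     C2_curve_family A \<epsilon>0 \<gamma> \<and>
     (\<exists>\<tau>. Ck_on 2 (\<lambda>(\<epsilon>, s). \<tau> \<epsilon> s :: real) ({0..<\<epsilon>0} \<times> UNIV) \<and>
          (\<forall>s. \<tau> 0 s = s) \<and>
          (\<forall>\<epsilon>\<in>{0..<\<epsilon>0}. strict_mono (\<tau> \<epsilon>) \<and> surj (\<tau> \<epsilon>)) \<and>
          uniform_C2_bounds A \<epsilon>0 (\<lambda>\<epsilon> s. \<gamma> \<epsilon> (\<tau> \<epsilon> s)))"


section \<open>Poincare sections and the time sequence\<close>

text \<open>\<open>h\<close> is a local defining function of the hypersurface \<open>\<Sigma>\<close> on the open set \<open>V\<close>.\<close>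

definition defining_function ::
    "('m::t2_space, 'n::finite) chart set \<Rightarrow> 'm set \<Rightarrow> 'm set \<Rightarrow> ('m \<Rightarrow> real) \<Rightarrow> bool" where
  "defining_function A \<Sigma> V h \<longleftrightarrow>
     open V \<and> Ck_function A 1 V h \<and> \<Sigma> \<inter> V = {q\<in>V. h q = 0} \<and>
     (\<forall>c\<in>A. \<forall>q\<in>fst c \<inter> V. \<exists>w. frechet_derivative (h \<circ> chart_inv c) (at (snd c q)) w \<noteq> 0)"

definition hypersurface :: "('m::t2_space, 'n::finite) chart set \<Rightarrow> 'm set \<Rightarrow> bool" where
  "hypersurface A \<Sigma> \<longleftrightarrow> (\<forall>p\<in>\<Sigma>. \<exists>V h. p \<in> V \<and> defining_function A \<Sigma> V h)"

text \<open>
  The tangent space of \<open>\<Sigma>\<close> at \<open>p\<close> is the kernel of \<open>dh\<close> at \<open>p\<close>, so an orbit of \<open>X\<close> crosses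
  \<open>\<Sigma>\<close> transversely at \<open>p\<close> iff \<open>dh(X)\<close> does not vanish at \<open>p\<close>.
\<close>

definition transverse_at ::
    "('m::t2_space, 'n::finite) chart set \<Rightarrow> 'm set \<Rightarrow> ('m, 'n) field \<Rightarrow> 'm \<Rightarrow> bool" where
  "transverse_at A \<Sigma> X p \<longleftrightarrow>
     p \<in> \<Sigma> \<and> (\<exists>V h. p \<in> V \<and> defining_function A \<Sigma> V h \<and> d_along A h X p \<noteq> 0)"

text \<open>
  That the section \<open>\<Sigma>\<close> is restricted to a sufficiently small neighbourhood of \<open>\<gamma>p 0\<close> enters
  through the properties of the intersection times, including \<open>\<gamma>h (T j) \<rightarrow> \<gamma>p 0\<close>.
\<close>

definition time_sequence ::
    "('m::t2_space, 'n::finite) chart set \<Rightarrow> ('m, 'n) field \<Rightarrow> (real \<Rightarrow> 'm) \<Rightarrow> (real \<Rightarrow> 'm) \<Rightarrow>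
     (int \<Rightarrow> real) \<Rightarrow> bool" where
  "time_sequence A X \<gamma>p \<gamma>h T \<longleftrightarrow>
     strict_mono T \<and> filterlim T at_top at_top \<and> filterlim T at_bot at_bot \<and>
     (\<not> equilibrium_orbit \<gamma>p \<longrightarrow>
        (\<exists>\<Sigma>. hypersurface A \<Sigma> \<and> transverse_at A \<Sigma> X (\<gamma>p 0) \<and>
             range T = {t. \<gamma>h t \<in> \<Sigma>} \<and>
             (\<forall>j. transverse_at A \<Sigma> X (\<gamma>h (T j))) \<and>
             ((\<lambda>j. \<gamma>h (T j)) \<longlongrightarrow> \<gamma>p 0) at_top \<and>
             ((\<lambda>j. \<gamma>h (T j)) \<longlongrightarrow> \<gamma>p 0) at_bot))"

end

theory Submission
  imports Defs
begin

text \<open>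
  The idea is to compute the increment of \<open>F\<close> along the perturbed homoclinic orbit in two ways.

  Put \<open>Q = dF(X1)\<close> and let \<open>J\<close> be a primitive of \<open>Q\<close> along an unperturbed orbit. Since
  \<open>dF(X0) = 0\<close>, the perturbed field satisfies \<open>dF(X \<epsilon>) = \<epsilon> Q + o(\<epsilon>)\<close> locally uniformly
  (\<open>d_along_quotient_tendsto\<close>), so on a bounded time interval any continuous family \<open>\<gamma> \<epsilon>\<close> of perturbed
  orbits has \<open>F (\<gamma> \<epsilon> t) - F (\<gamma> \<epsilon> s) = \<epsilon> (J t - J s) + o(\<epsilon>)\<close> (\<open>F_increment_uniform\<close>). The
  integral in the theorem is \<open>J (T k) - J (T (-k))\<close> for the homoclinic orbit, and it remains to see
  that this tends to \<open>0\<close>.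

  First, the expansion is uniform in time: for all \<open>s, s'\<close> such that the unperturbed homoclinic
  orbit is close to the base point \<open>\<gamma>p 0\<close> at these times, the remainder is at most
  \<open>\<epsilon> \<eta>\<close> for all \<open>\<epsilon>\<close> below a bound depending only on \<open>\<eta>\<close>
  (\<open>F_increment_uniform_in_time\<close>). Here the uniform bounds on two \<open>\<epsilon>\<close>-derivatives enter: they make
  the difference quotient of \<open>F\<close> in \<open>\<epsilon>\<close> almost constant in \<open>\<epsilon>\<close>, uniformly in time, and the limit of
  the quotient is known from the expansion on bounded intervals. The change of time does not
  contribute to this limit, because it moves points along the orbit, where \<open>F\<close> is constant for
  \<open>\<epsilon> = 0\<close>.

  Secondly, for fixed \<open>\<epsilon>\<close> and large \<open>k\<close> both end points lie close to the perturbed periodic orbit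
  and in a small neighbourhood of \<open>\<gamma>p 0\<close>. On that part of the perturbed periodic orbit \<open>F\<close>
  oscillates by at most \<open>\<epsilon> \<eta>\<close> (\<open>F_oscillation_near_base_point\<close>). Indeed, periodicity of the perturbed
  orbits makes the primitive \<open>J\<close> along \<open>\<gamma>p\<close> periodic, by uniqueness of solutions \<open>J\<close> then takes the
  same value at all times when \<open>\<gamma>p\<close> passes through \<open>\<gamma>p 0\<close>, and the expansion on bounded intervals
  shows that \<open>F\<close> varies like \<open>\<epsilon> J\<close>.

  Choosing \<open>\<epsilon>\<close> small and then \<open>k\<close> large gives \<open>\<epsilon> \<bar>J (T k) - J (T (-k))\<bar> \<le> const \<cdot> \<epsilon> \<eta>\<close>
  (\<open>primitive_increment_tendsto_0\<close>).
\<close>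

section \<open>Limits along product filters and one-sided limits\<close>

text \<open>
  Joint limits in the parameter and in time are turned into estimates uniform over a compact time
  interval: finitely many of the neighbourhoods of the single times cover it.
\<close>

lemma eventually_ball_compact:
  fixes F :: "'b filter"
  assumes "compact K"
    and "\<And>t. t \<in> K \<Longrightarrow> eventually (\<lambda>(e, t'). P e t') (F \<times>\<^sub>F nhds t)"
  shows "eventually (\<lambda>e. \<forall>t\<in>K. P e t) F"
proof -
  have "\<exists>U. open U \<and> t \<in> U \<and> eventually (\<lambda>e. \<forall>t'\<in>U. P e t') F" if "t \<in> K" for t
  proof -
    from assms(2)[OF that] obtain Pf Pg where "eventually Pf F" "eventually Pg (nhds t)"
      and *: "\<And>x y. Pf x \<Longrightarrow> Pg y \<Longrightarrow> P x y"
      unfolding eventually_prod_filter by auto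
    from this(2) obtain U where "open U" "t \<in> U" "\<forall>y\<in>U. Pg y"
      unfolding eventually_nhds by auto
    with * \<open>eventually Pf F\<close> show ?thesis
      by (intro exI[of _ U]) (auto elim: eventually_mono)
  qed
  then have "\<forall>t\<in>K. \<exists>U. open U \<and> t \<in> U \<and> eventually (\<lambda>e. \<forall>t'\<in>U. P e t') F"
    by blast
  from bchoice[OF this] obtain U where
    U: "\<forall>t\<in>K. open (U t) \<and> t \<in> U t \<and> eventually (\<lambda>e. \<forall>t'\<in>U t. P e t') F" ..
  obtain C where C: "C \<subseteq> K" "finite C" "K \<subseteq> (\<Union>t\<in>C. U t)"
    using compactE_image[OF assms(1), of K U] U by blast
  have "eventually (\<lambda>e. \<forall>t\<in>C. \<forall>t'\<in>U t. P e t') F"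
    using C U by (intro eventually_ball_finite) auto
  then show ?thesis
    by (rule eventually_mono) (use C in blast)
qed

lemma eventually_at_right_within:
  fixes a b :: real
  assumes "a < b" "eventually P (at a within {a..<b})"
  shows "eventually P (at_right a)"
proof -
  from assms(2) obtain d where d: "d > 0" "\<And>x. x \<in> {a..<b} \<Longrightarrow> x \<noteq> a \<Longrightarrow> dist x a < d \<Longrightarrow> P x"
    unfolding eventually_at by blast
  show ?thesis unfolding eventually_at_right_field
    by (rule exI[of _ "min b (a + d)"]) (use d assms in \<open>auto simp: dist_real_def\<close>)
qed

lemma tendsto_at_right_within:
  fixes a b :: real
  assumes "a < b" "(f \<longlongrightarrow> l) (at a within {a..<b})"
  shows "(f \<longlongrightarrow> l) (at_right a)"
  using assms unfolding tendsto_def by (auto intro: eventually_at_right_within)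

lemma tendsto_prod_at_right:
  fixes g :: "real \<times> 'a::topological_space \<Rightarrow> 'b::topological_space" and e0 :: real
  assumes "continuous_on ({0..<e0} \<times> U) g" "open U" "u \<in> U" "e0 > 0"
  shows "(g \<longlongrightarrow> g (0, u)) (at_right 0 \<times>\<^sub>F nhds u)"
proof (rule topological_tendstoI)
  fix S assume "open S" "g (0, u) \<in> S"
  with assms obtain B where B: "open B" "B \<inter> ({0..<e0} \<times> U) = g -` S \<inter> ({0..<e0} \<times> U)"
    unfolding continuous_on_open_invariant by metis
  have "(0, u) \<in> B" using B assms \<open>g (0, u) \<in> S\<close> by auto
  with B(1) obtain C D where CD: "open C" "open D" "0 \<in> C" "u \<in> D" "C \<times> D \<subseteq> B"
    by (auto elim!: open_prod_elim)
  have "eventually (\<lambda>e. e \<in> C \<and> e \<in> {0..<e0}) (at_right 0)"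
    using CD assms(4) eventually_at_right_less[of "0::real"]
      by (intro eventually_conj eventually_at_right_within[OF assms(4)])
       (auto simp: eventually_at_filter eventually_nhds intro!: exI[of _ C])
  moreover have "eventually (\<lambda>v. v \<in> D \<inter> U) (nhds u)"
    using CD assms by (intro eventually_nhds_in_open) auto
  ultimately have "eventually (\<lambda>(e, v). (e, v) \<in> B \<inter> ({0..<e0} \<times> U)) (at_right 0 \<times>\<^sub>F nhds u)"
    by (rule eventually_prodI[THEN eventually_mono]) (use CD in auto)
  then show "eventually (\<lambda>z. g z \<in> S) (at_right 0 \<times>\<^sub>F nhds u)"
    unfolding B(2) by (auto elim: eventually_mono)
qed

section \<open>Differentiable maps between Euclidean spaces\<close>

lemma Ck_on_imp_continuous_on: "Ck_on k f S \<Longrightarrow> continuous_on S f"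
  by (cases k) (auto intro: has_derivative_continuous_on)

lemma Ck_on_SucE:
  assumes "Ck_on (Suc k) f S"
  obtains f' where "\<And>x. x \<in> S \<Longrightarrow> (f has_derivative f' x) (at x within S)"
    "\<And>v. continuous_on S (\<lambda>x. f' x v)"
  using assms Ck_on_imp_continuous_on by (metis Ck_on.simps(2))

lemma Ck_on_Suc_open:
  assumes "Ck_on (Suc k) f S" "open S"
  shows "x \<in> S \<Longrightarrow> (f has_derivative frechet_derivative f (at x)) (at x)"
    and "continuous_on S (\<lambda>x. frechet_derivative f (at x) v)"
proof -
  obtain f' where f': "\<And>x. x \<in> S \<Longrightarrow> (f has_derivative f' x) (at x)"
    "\<And>v. continuous_on S (\<lambda>x. f' x v)"
    using Ck_on_SucE[OF assms(1)] at_within_open[OF _ assms(2)] by metis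
  show "x \<in> S \<Longrightarrow> (f has_derivative frechet_derivative f (at x)) (at x)"
    using f'(1) frechet_derivative_at by metis
  show "continuous_on S (\<lambda>x. frechet_derivative f (at x) v)"
    by (rule continuous_on_eq[OF f'(2)[of v]]) (metis f'(1) frechet_derivative_at)
qed

text \<open>
  By the mean value inequality the difference quotient at \<open>v\<close> is close to the derivative at
  \<open>(v, 0)\<close>, with an error controlled by the oscillation of the derivative near \<open>(u, 0)\<close>. Hence it converges
  even when the base point \<open>v\<close> moves along with the parameter.
\<close>

lemma difference_quotient_tendsto:
  fixes g :: "'a::real_normed_vector \<times> real \<Rightarrow> 'b::real_normed_vector"
  assumes "open U" "u \<in> U" "e0 > 0"
    and der: "\<And>z. z \<in> U \<times> {0..<e0} \<Longrightarrow> (g has_derivative g' z) (at z within U \<times> {0..<e0})"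
    and cont: "continuous_on (U \<times> {0..<e0}) (\<lambda>z. g' z (0, 1))"
  shows "((\<lambda>(e, v). (g (v, e) - g (v, 0)) /\<^sub>R e) \<longlongrightarrow> g' (u, 0) (0, 1)) (at_right 0 \<times>\<^sub>F nhds u)"
proof (rule tendstoI)
  fix r :: real assume "r > 0"
  let ?w = "\<lambda>z. g' z (0, 1)"
  obtain d where "d > 0"
    and d: "\<And>z. z \<in> U \<times> {0..<e0} \<Longrightarrow> dist z (u, 0) < d \<Longrightarrow> dist (?w z) (?w (u, 0)) < r / 4"
    using cont[unfolded continuous_on_iff, rule_format, of "(u, 0)" "r / 4"] assms(2,3) \<open>r > 0\<close> by auto
  have near: "dist (?w (v, s)) (?w (u, 0)) < r / 4"
    if "v \<in> U" "dist v u < d / 2" "0 \<le> s" "s < d / 2" "s < e0" for v s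
  proof (rule d)
    have "dist (v, s) (u, 0) \<le> dist v u + dist s 0"
      using sqrt_sum_squares_le_sum_abs[of "dist v u" "dist s 0"] by (simp add: dist_prod_def)
    then show "dist (v, s) (u, 0) < d" using that by simp
  qed (use that in auto)
  have "eventually (\<lambda>e. 0 < e \<and> e < min (d / 2) e0) (at_right (0::real))"
    using \<open>d > 0\<close> assms(3) by (auto simp: eventually_at_right_field intro!: exI[of _ "min (d / 2) e0"])
  moreover have "eventually (\<lambda>v. dist v u < d / 2 \<and> v \<in> U) (nhds u)"
    using eventually_nhds_in_open[of "ball u (d / 2) \<inter> U" u] assms(1,2) \<open>d > 0\<close>
    by (auto simp: dist_commute open_Int)
  ultimately show "eventually (\<lambda>x. dist (case x of (e, v) \<Rightarrow> (g (v, e) - g (v, 0)) /\<^sub>R e) (?w (u, 0)) < r)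
          (at_right 0 \<times>\<^sub>F nhds u)"
  proof (rule eventually_prodI[THEN eventually_mono], clarsimp)
    fix e v assume e: "0 < e" "e * 2 < d" "e < e0" and v: "dist v u * 2 < d" "v \<in> U"
    have vd: "((\<lambda>s. g (v, s)) has_vector_derivative ?w (v, s)) (at s within {0..e})"
      if s: "s \<in> {0..e}" for s
    proof -
      have 1: "(g has_derivative g' (v, s)) (at (v, s) within (\<lambda>s. (v, s)) ` {0..e})"
        by (rule has_derivative_subset[OF der]) (use s e v in auto)
      have 2: "((\<lambda>s. (v, s)) has_derivative (\<lambda>h. (0, h))) (at s within {0..e})"
        by (auto intro!: derivative_eq_intros)
      have lin: "linear (g' (v, s))" using der[of "(v, s)"] s e v
        by (auto intro: has_derivative_linear)
      have w: "g' (v, s) (0, h) = h *\<^sub>R ?w (v, s)" for h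
        using linear_cmul[OF lin, of h "(0, 1)"] by simp
      have "g' (v, s) \<circ> (\<lambda>h. (0, h)) = (\<lambda>h. h *\<^sub>R ?w (v, s))"
        by (intro ext, unfold o_apply, rule w)
      with diff_chain_within[OF 2 1]
      have "((g \<circ> (\<lambda>s. (v, s))) has_derivative (\<lambda>h. h *\<^sub>R ?w (v, s))) (at s within {0..e})"
        by (simp only:)
      then show ?thesis
        unfolding has_vector_derivative_def o_def .
    qed
    have w0: "dist (?w (v, s)) (?w (v, 0)) \<le> r / 2" if s: "s \<in> {0..e}" for s
      using near[of v s] near[of v 0] v e s
        dist_triangle_half_l[of "?w (v, s)" "?w (u, 0)" "r/2" "?w (v, 0)"] by auto
    have "norm (g (v, e) - g (v, 0) - (e - 0) *\<^sub>R ?w (v, 0)) \<le> norm (e - 0) * (r / 2)"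
      by (rule vector_differentiable_bound_linearization[OF vd])
         (use w0 e in \<open>auto simp: dist_norm closed_segment_eq_real_ivl\<close>)
    then have n: "norm (g (v, e) - g (v, 0) - e *\<^sub>R ?w (v, 0)) \<le> e * (r / 2)" using e by simp
    have "(g (v, e) - g (v, 0)) /\<^sub>R e - ?w (v, 0) = (g (v, e) - g (v, 0) - e *\<^sub>R ?w (v, 0)) /\<^sub>R e"
      using e by (simp add: algebra_simps)
    then have "dist ((g (v, e) - g (v, 0)) /\<^sub>R e) (?w (v, 0)) \<le> r / 2"
      using n e by (simp add: dist_norm divide_simps mult.commute)
    with near[of v 0] v e \<open>r > 0\<close>
    show "dist ((g (v, e) - g (v, 0)) /\<^sub>R e) (?w (u, 0)) < r"
      using dist_triangle[of "(g (v, e) - g (v, 0)) /\<^sub>R e" "?w (u, 0)" "?w (v, 0)"] by linarith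
  qed
qed

text \<open>
  In finite dimension, pointwise convergence of linear maps suffices for convergence at
  moving arguments. This matches the way continuity of a derivative is expressed by \<open>Ck_on\<close>.
\<close>

lemma linear_tendsto_pointwise:
  fixes L :: "'z \<Rightarrow> 'a::euclidean_space \<Rightarrow> 'b::real_normed_vector"
  assumes "eventually (\<lambda>z. linear (L z)) F" "linear L0"
    and "\<And>b. b \<in> Basis \<Longrightarrow> ((\<lambda>z. L z b) \<longlongrightarrow> L0 b) F" "(w \<longlongrightarrow> w0) F"
  shows "((\<lambda>z. L z (w z)) \<longlongrightarrow> L0 w0) F"
proof -
  have eq: "l v = (\<Sum>b\<in>Basis. (v \<bullet> b) *\<^sub>R l b)" if "linear l" for l :: "'a \<Rightarrow> 'b" and v
    by (metis (no_types, lifting) that euclidean_representation linear_scale linear_sum sum.cong)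
  have "((\<lambda>z. \<Sum>b\<in>Basis. (w z \<bullet> b) *\<^sub>R L z b) \<longlongrightarrow> (\<Sum>b\<in>Basis. (w0 \<bullet> b) *\<^sub>R L0 b)) F"
    using assms by (intro tendsto_intros) auto
  then have "((\<lambda>z. \<Sum>b\<in>Basis. (w z \<bullet> b) *\<^sub>R L z b) \<longlongrightarrow> L0 w0) F"
    using eq[OF assms(2), of w0] by simp
  then show ?thesis
    by (rule Lim_transform_eventually)
       (use assms(1) eq in \<open>auto elim!: eventually_mono\<close>)
qed


section \<open>Charts and the derivative of a function along a field\<close>

context
  fixes A :: "('m::t2_space, 'n::finite) chart set"
  assumes manifold: "oriented_C3_manifold A"
begin

lemma chart_around: obtains c where "c \<in> A" "p \<in> fst c"
  using manifold unfolding oriented_C3_manifold_def by blast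

lemma chart_homeomorphism:
  assumes "c \<in> A"
  shows open_chart_domain: "open (fst c)"
    and open_chart_image: "open (snd c ` fst c)"
    and continuous_on_chart: "continuous_on (fst c) (snd c)"
    and continuous_on_chart_inv: "continuous_on (snd c ` fst c) (chart_inv c)"
    and chart_inv_chart: "p \<in> fst c \<Longrightarrow> chart_inv c (snd c p) = p"
  using manifold assms unfolding oriented_C3_manifold_def homeomorphism_def by auto

lemma open_chart_image_Int:
  assumes "c \<in> A" "open V"
  shows "open (snd c ` (fst c \<inter> V))"
proof -
  have "homeomorphism (fst c) (snd c ` fst c) (snd c) (chart_inv c)"
    using manifold assms unfolding oriented_C3_manifold_def by auto
  from homeomorphism_imp_open_map[OF this, of "fst c \<inter> V"] show ?thesis
    using open_chart_image[OF assms(1)] assms(2) by (simp add: openin_open_Int openin_open_eq)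
qed

lemma isCont_chart:
  assumes "c \<in> A" "p \<in> fst c"
  shows "isCont (snd c) p"
  using continuous_on_chart[OF assms(1)] assms(2)
  unfolding continuous_on_eq_continuous_at[OF open_chart_domain[OF assms(1)]] by (rule bspec)

lemma tendsto_chart:
  assumes "c \<in> A" "p \<in> fst c"
  shows "(snd c \<longlongrightarrow> snd c p) (nhds p)"
  using isCont_chart[OF assms] unfolding isCont_def tendsto_at_iff_tendsto_nhds .

lemma Ck_function_chart_derivative:
  assumes "Ck_function A (Suc k) W F" "open W" "c \<in> A"
  shows "u \<in> snd c ` (fst c \<inter> W) \<Longrightarrow>
      ((F \<circ> chart_inv c) has_derivative frechet_derivative (F \<circ> chart_inv c) (at u)) (at u)"
    and "continuous_on (snd c ` (fst c \<inter> W)) (\<lambda>u. frechet_derivative (F \<circ> chart_inv c) (at u) v)"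
proof -
  have "Ck_on (Suc k) (F \<circ> chart_inv c) (snd c ` (fst c \<inter> W))"
    using assms(1,3) unfolding Ck_function_def by blast
  note * = Ck_on_Suc_open[OF this open_chart_image_Int[OF assms(3,2)]]
  show "u \<in> snd c ` (fst c \<inter> W) \<Longrightarrow>
      ((F \<circ> chart_inv c) has_derivative frechet_derivative (F \<circ> chart_inv c) (at u)) (at u)"
    by (rule *(1))
  show "continuous_on (snd c ` (fst c \<inter> W)) (\<lambda>u. frechet_derivative (F \<circ> chart_inv c) (at u) v)"
    by (rule *(2))
qed

text \<open>
  The transformation rule of \<open>Y\<close> and the chain rule for a change of chart cancel, which frees the
  differential from the arbitrary chart chosen in its definition.
\<close>

lemma d_along_chart:
  assumes "Ck_function A (Suc k) W F" "open W" "vector_field A Y" "c \<in> A" "p \<in> fst c" "p \<in> W"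
  shows "d_along A F Y p = frechet_derivative (F \<circ> chart_inv c) (at (snd c p)) (Y c p)"
proof -
  define c' where "c' = (SOME c. c \<in> A \<and> p \<in> fst c)"
  have c': "c' \<in> A" "p \<in> fst c'"
    using someI[of "\<lambda>c. c \<in> A \<and> p \<in> fst c" c] assms unfolding c'_def by auto
  let ?\<phi> = "transition c c'" and ?u = "snd c p"
  have phi: "?\<phi> ?u = snd c' p" using chart_inv_chart assms by simp
  have "Ck_on (Suc 2) ?\<phi> (snd c ` (fst c \<inter> fst c'))"
    using manifold c' assms unfolding oriented_C3_manifold_def by (simp add: numeral_3_eq_3)
  from Ck_on_Suc_open(1)[OF this open_chart_image_Int[OF assms(4) open_chart_domain[OF c'(1)]], of ?u]
  have d1: "(?\<phi> has_derivative frechet_derivative ?\<phi> (at ?u)) (at ?u)"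
    using c' assms by blast
  have d2: "((F \<circ> chart_inv c') has_derivative frechet_derivative (F \<circ> chart_inv c') (at (snd c' p)))
      (at (?\<phi> ?u))"
    unfolding phi by (rule Ck_function_chart_derivative(1)[OF assms(1,2) c'(1)]) (use assms c' in auto)
  have "((F \<circ> chart_inv c) has_derivative
      frechet_derivative (F \<circ> chart_inv c') (at (snd c' p)) \<circ> frechet_derivative ?\<phi> (at ?u)) (at ?u)"
  proof (rule has_derivative_transform_within_open[OF diff_chain_at[OF d1 d2]
      open_chart_image_Int[OF assms(4) open_chart_domain[OF c'(1)]]])
    fix x assume "x \<in> snd c ` (fst c \<inter> fst c')"
    then show "(F \<circ> chart_inv c' \<circ> ?\<phi>) x = (F \<circ> chart_inv c) x"
      using chart_inv_chart assms(4) c' by auto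
  qed (use assms c' in auto)
  then have "frechet_derivative (F \<circ> chart_inv c) (at ?u) =
      frechet_derivative (F \<circ> chart_inv c') (at (snd c' p)) \<circ> frechet_derivative ?\<phi> (at ?u)"
    by (rule frechet_derivative_at[symmetric])
  moreover have "Y c' p = frechet_derivative ?\<phi> (at ?u) (Y c p)"
    using assms c' unfolding vector_field_def by blast
  ultimately show ?thesis
    unfolding d_along_def c'_def[symmetric] Let_def by simp
qed

lemma has_derivative_along_integral_curve:
  assumes "Ck_function A (Suc k) W F" "open W" "vector_field A Y" "integral_curve A Y \<gamma>" "\<gamma> t \<in> W"
  shows "((\<lambda>t. F (\<gamma> t)) has_vector_derivative d_along A F Y (\<gamma> t)) (at t)"
proof -
  obtain c where c: "c \<in> A" "\<gamma> t \<in> fst c" by (rule chart_around)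
  have cont: "continuous_on UNIV \<gamma>" using assms(4) unfolding integral_curve_def by auto
  have d1: "((snd c \<circ> \<gamma>) has_vector_derivative Y c (\<gamma> t)) (at t)"
    using assms(4) c unfolding integral_curve_def by auto
  have "((F \<circ> chart_inv c) has_derivative frechet_derivative (F \<circ> chart_inv c) (at (snd c (\<gamma> t))))
      (at ((snd c \<circ> \<gamma>) t))"
    unfolding o_apply[of "snd c"]
    by (rule Ck_function_chart_derivative(1)[OF assms(1,2) c(1)]) (use c assms in auto)
  from vector_derivative_diff_chain_within[OF d1 has_derivative_at_withinI[OF this]]
  have "((F \<circ> chart_inv c \<circ> (snd c \<circ> \<gamma>)) has_vector_derivative d_along A F Y (\<gamma> t)) (at t)"
    unfolding d_along_chart[OF assms(1-3) c assms(5)] .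
  then show ?thesis
    by (rule has_vector_derivative_transform_within_open[of _ _ _ "\<gamma> -` fst c"])
      (use chart_inv_chart c open_vimage[OF open_chart_domain[OF c(1)] cont] in auto)
qed

end


section \<open>A first integral of the unperturbed field\<close>

locale perturbed_first_integral =
  fixes A :: "('m::t2_space, 'n::finite) chart set"
    and X :: "real \<Rightarrow> ('m, 'n) field" and X0 X1 :: "('m, 'n) field"
    and \<epsilon>0 :: real and F :: "'m \<Rightarrow> real" and W :: "'m set"
  assumes manifold: "oriented_C3_manifold A"
    and \<epsilon>0_pos: "\<epsilon>0 > 0"
    and field_family: "C2_field_family A \<epsilon>0 X"
    and expansion: "first_order_expansion A X X0 X1"
    and open_W: "open W"
    and F_smooth: "Ck_function A 3 W F"
    and F_integral: "first_integral_on A X0 W F"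
begin

lemma F_Suc: "Ck_function A (Suc 2) W F"
  using F_smooth by (simp add: numeral_3_eq_3)

lemma continuous_on_F: "continuous_on W F"
proof (rule continuous_at_imp_continuous_on, rule ballI)
  fix p assume p: "p \<in> W"
  obtain c where c: "c \<in> A" "p \<in> fst c" by (rule chart_around[OF manifold])
  have F: "isCont (F \<circ> chart_inv c) (snd c p)"
    using Ck_function_chart_derivative(1)[OF manifold F_Suc open_W c(1)] p c
    by (intro has_derivative_continuous) auto
  from continuous_at_compose[OF isCont_chart[OF manifold c] F] have "isCont ((F \<circ> chart_inv c) \<circ> snd c) p" .
  moreover have "eventually (\<lambda>q. ((F \<circ> chart_inv c) \<circ> snd c) q = F q) (nhds p)"
    using eventually_nhds_in_open[OF open_chart_domain[OF manifold c(1)] c(2)]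
    by eventually_elim (simp add: chart_inv_chart[OF manifold c(1)])
  ultimately show "isCont F p" using isCont_cong by blast
qed

lemma vector_fields: "vector_field A X0" "vector_field A X1" "\<epsilon> \<in> {0..<\<epsilon>0} \<Longrightarrow> vector_field A (X \<epsilon>)"
  using expansion field_family unfolding first_order_expansion_def C2_field_family_def by auto

lemma eventually_parameter: "eventually (\<lambda>\<epsilon>. \<epsilon> \<in> {0<..<\<epsilon>0}) (at_right 0)"
  using \<epsilon>0_pos by (rule eventually_at_right_real)

lemma expansion_tendsto:
  assumes "c \<in> A" "p \<in> fst c"
  shows "((\<lambda>\<epsilon>. X \<epsilon> c p) \<longlongrightarrow> X0 c p) (at_right 0)"
    and "((\<lambda>\<epsilon>. (X \<epsilon> c p - X0 c p) /\<^sub>R \<epsilon>) \<longlongrightarrow> X1 c p) (at_right 0)"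
proof -
  let ?r = "\<lambda>\<epsilon>. X \<epsilon> c p - (X0 c p + \<epsilon> *\<^sub>R X1 c p)"
  have "(\<lambda>\<epsilon>. norm (?r \<epsilon>)) \<in> O[at_right 0](\<lambda>\<epsilon>. \<epsilon>\<^sup>2)"
    using expansion assms unfolding first_order_expansion_def by blast
  then obtain C where "eventually (\<lambda>\<epsilon>. norm (norm (?r \<epsilon>)) \<le> C * norm (\<epsilon>\<^sup>2)) (at_right 0)"
    by (rule landau_o.bigE)
  then have ev: "eventually (\<lambda>\<epsilon>. norm (?r \<epsilon> /\<^sub>R \<epsilon>) \<le> C * \<epsilon>) (at_right 0)"
    using eventually_at_right_less
  proof eventually_elim
    case (elim \<epsilon>)
    then show ?case by (simp add: power2_eq_square divide_simps ac_simps)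
  qed
  have "((\<lambda>\<epsilon>. C * \<epsilon>) \<longlongrightarrow> C * 0) (at_right (0::real))" by (intro tendsto_intros)
  then have lim: "((\<lambda>\<epsilon>. ?r \<epsilon> /\<^sub>R \<epsilon>) \<longlongrightarrow> 0) (at_right 0)"
    using Lim_null_comparison[OF ev] by simp
  have "((\<lambda>\<epsilon>. ?r \<epsilon> /\<^sub>R \<epsilon> + X1 c p) \<longlongrightarrow> X1 c p) (at_right 0)"
    using tendsto_add[OF lim tendsto_const[of "X1 c p"]] by simp
  then show 1: "((\<lambda>\<epsilon>. (X \<epsilon> c p - X0 c p) /\<^sub>R \<epsilon>) \<longlongrightarrow> X1 c p) (at_right 0)"
    by (rule Lim_transform_eventually)
      (use eventually_at_right_less[of "0::real"] in
        \<open>auto elim!: eventually_mono simp: algebra_simps\<close>)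
  have "((\<lambda>\<epsilon>. X0 c p + \<epsilon> *\<^sub>R ((X \<epsilon> c p - X0 c p) /\<^sub>R \<epsilon>)) \<longlongrightarrow> X0 c p) (at_right 0)"
    using tendsto_add[OF tendsto_const tendsto_scaleR[OF tendsto_ident_at 1]] by simp
  then show "((\<lambda>\<epsilon>. X \<epsilon> c p) \<longlongrightarrow> X0 c p) (at_right 0)"
    by (rule Lim_transform_eventually)
      (use eventually_at_right_less[of "0::real"] in \<open>auto elim!: eventually_mono\<close>)
qed

lemma field_at_zero:
  assumes "c \<in> A" "p \<in> fst c"
  shows "X 0 c p = X0 c p"
proof -
  let ?g = "\<lambda>(u, \<epsilon>). X \<epsilon> c (chart_inv c u)"
  have "continuous_on ((snd c ` fst c) \<times> {0..<\<epsilon>0}) ?g"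
    using field_family assms Ck_on_imp_continuous_on unfolding C2_field_family_def by blast
  then have "continuous_on {0..<\<epsilon>0} (\<lambda>\<epsilon>. ?g (snd c p, \<epsilon>))"
    by (rule continuous_on_compose2) (use assms in \<open>auto intro!: continuous_intros\<close>)
  then have "((\<lambda>\<epsilon>. X \<epsilon> c p) \<longlongrightarrow> X 0 c p) (at 0 within {0..<\<epsilon>0})"
    using \<epsilon>0_pos chart_inv_chart[OF manifold] assms unfolding continuous_on_def by auto
  from tendsto_unique[OF _ tendsto_at_right_within[OF \<epsilon>0_pos this] expansion_tendsto(1)[OF assms]]
  show ?thesis by simp
qed

text \<open>
  The first-order expansion is assumed only at each single point. Smoothness of the family gives a
  limit that is uniform near \<open>p\<close>, and the pointwise expansion identifies it.
\<close>

lemma field_quotient_tendsto: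
  assumes "c \<in> A" "p \<in> fst c"
  shows "((\<lambda>(\<epsilon>, q). (X \<epsilon> c q - X0 c q) /\<^sub>R \<epsilon>) \<longlongrightarrow> X1 c p) (at_right 0 \<times>\<^sub>F nhds p)"
proof -
  let ?U = "snd c ` fst c" and ?g = "\<lambda>(u, \<epsilon>). X \<epsilon> c (chart_inv c u)"
  note inv = chart_inv_chart[OF manifold assms(1)]
  have "Ck_on (Suc (Suc 0)) ?g (?U \<times> {0..<\<epsilon>0})"
    using field_family assms unfolding C2_field_family_def by (auto simp: numeral_2_eq_2)
  then obtain g' where "\<And>x. x \<in> ?U \<times> {0..<\<epsilon>0} \<Longrightarrow> (?g has_derivative g' x) (at x within ?U \<times> {0..<\<epsilon>0})"
    "\<And>v. continuous_on (?U \<times> {0..<\<epsilon>0}) (\<lambda>x. g' x v)" by (rule Ck_on_SucE) (rule that)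
  from difference_quotient_tendsto[OF open_chart_image[OF manifold assms(1)] _ \<epsilon>0_pos this, of "snd c p"]
  have lim: "((\<lambda>(\<epsilon>, v). (?g (v, \<epsilon>) - ?g (v, 0)) /\<^sub>R \<epsilon>) \<longlongrightarrow> g' (snd c p, 0) (0, 1))
      (at_right 0 \<times>\<^sub>F nhds (snd c p))"
    using assms by auto
  have "filterlim (\<lambda>z. (fst z, snd c (snd z))) (at_right 0 \<times>\<^sub>F nhds (snd c p)) (at_right 0 \<times>\<^sub>F nhds p)"
    by (intro filterlim_Pair filterlim_fst filterlim_compose[OF tendsto_chart[OF manifold assms] filterlim_snd])
  from filterlim_compose[OF lim this]
  have lim: "((\<lambda>z. (?g (snd c (snd z), fst z) - ?g (snd c (snd z), 0)) /\<^sub>R fst z) \<longlongrightarrow> g' (snd c p, 0) (0, 1))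
      (at_right 0 \<times>\<^sub>F nhds p)"
    by simp
  have near: "eventually (\<lambda>z. snd z \<in> fst c) (at_right 0 \<times>\<^sub>F nhds p)"
    using filterlim_snd eventually_nhds_in_open[OF open_chart_domain[OF manifold assms(1)] assms(2)]
    by (rule eventually_compose_filterlim[rotated])
  from lim near have lim': "((\<lambda>(\<epsilon>, q). (X \<epsilon> c q - X0 c q) /\<^sub>R \<epsilon>) \<longlongrightarrow> g' (snd c p, 0) (0, 1))
      (at_right 0 \<times>\<^sub>F nhds p)"
    by (elim Lim_transform_eventually)
      (auto elim!: eventually_mono simp: inv field_at_zero[OF assms(1)])
  have "filterlim (\<lambda>\<epsilon>. (\<epsilon>, p)) (at_right (0::real) \<times>\<^sub>F nhds p) (at_right 0)"
    by (intro filterlim_Pair filterlim_ident tendsto_const)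
  from filterlim_compose[OF lim' this] have "g' (snd c p, 0) (0, 1) = X1 c p"
    using expansion_tendsto(2)[OF assms] by (intro tendsto_unique[OF _ _ expansion_tendsto(2)[OF assms]]) auto
  with lim' show ?thesis by simp
qed

text \<open>
  As \<open>dF(X0)\<close> vanishes, \<open>dF(X \<epsilon>)\<close> equals \<open>dF(X \<epsilon> - X0)\<close>, so dividing by \<open>\<epsilon>\<close> leaves \<open>dF\<close> applied
  to the difference quotient of the field.
\<close>

lemma d_along_quotient_tendsto:
  assumes "p \<in> W"
  shows "((\<lambda>(\<epsilon>, q). d_along A F (X \<epsilon>) q / \<epsilon>) \<longlongrightarrow> d_along A F X1 p) (at_right 0 \<times>\<^sub>F nhds p)"
proof -
  obtain c where c: "c \<in> A" "p \<in> fst c" by (rule chart_around[OF manifold])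
  let ?U = "snd c ` (fst c \<inter> W)"
  define D where "D u = frechet_derivative (F \<circ> chart_inv c) (at u)" for u
  note D = Ck_function_chart_derivative[OF manifold F_Suc open_W c(1), folded D_def]
  note dal = d_along_chart[OF manifold F_Suc open_W _ c(1), folded D_def]
  have lin: "linear (D (snd c q))" if "q \<in> fst c \<inter> W" for q
    using D(1)[of "snd c q"] that by (auto intro: has_derivative_linear)
  have near: "eventually (\<lambda>z. snd z \<in> fst c \<inter> W) (at_right (0::real) \<times>\<^sub>F nhds p)"
    using filterlim_snd eventually_nhds_in_open[OF open_Int[OF open_chart_domain[OF manifold c(1)] open_W]]
    by (rule eventually_compose_filterlim[rotated]) (use c assms in auto)
  have par: "eventually (\<lambda>z. fst z \<in> {0<..<\<epsilon>0}) (at_right (0::real) \<times>\<^sub>F nhds p)"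
    using filterlim_fst eventually_parameter by (rule eventually_compose_filterlim[rotated])
  have "((\<lambda>z. D (snd c (snd z)) ((X (fst z) c (snd z) - X0 c (snd z)) /\<^sub>R fst z)) \<longlongrightarrow>
      D (snd c p) (X1 c p)) (at_right 0 \<times>\<^sub>F nhds p)"
  proof (rule linear_tendsto_pointwise[where L = "\<lambda>z. D (snd c (snd z))"])
    show "eventually (\<lambda>z. linear (D (snd c (snd z)))) (at_right (0::real) \<times>\<^sub>F nhds p)"
      using near by (rule eventually_mono) (rule lin)
    show "linear (D (snd c p))" using lin c assms by blast
    show "((\<lambda>z. (X (fst z) c (snd z) - X0 c (snd z)) /\<^sub>R fst z) \<longlongrightarrow> X1 c p) (at_right 0 \<times>\<^sub>F nhds p)"
      using field_quotient_tendsto[OF c] by (simp add: case_prod_unfold)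
    fix b :: "real ^ 'n"
    have "isCont (\<lambda>u. D u b) (snd c p)"
      using D(2)[of b] open_chart_image_Int[OF manifold c(1) open_W] c assms
      by (auto simp: continuous_on_eq_continuous_at)
    then have "((\<lambda>u. D u b) \<longlongrightarrow> D (snd c p) b) (nhds (snd c p))"
      unfolding isCont_def tendsto_at_iff_tendsto_nhds[of "\<lambda>u. D u b"] .
    then show "((\<lambda>z. D (snd c (snd z)) b) \<longlongrightarrow> D (snd c p) b) (at_right (0::real) \<times>\<^sub>F nhds p)"
      using filterlim_compose[OF tendsto_chart[OF manifold c] filterlim_snd]
      by (rule filterlim_compose)
  qed
  then have "((\<lambda>z. d_along A F (X (fst z)) (snd z) / fst z) \<longlongrightarrow> d_along A F X1 p) (at_right 0 \<times>\<^sub>F nhds p)"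
    unfolding dal[OF vector_fields(2) c(2) assms]
  proof (rule Lim_transform_eventually)
    show "eventually (\<lambda>z. D (snd c (snd z)) ((X (fst z) c (snd z) - X0 c (snd z)) /\<^sub>R fst z) =
        d_along A F (X (fst z)) (snd z) / fst z) (at_right 0 \<times>\<^sub>F nhds p)"
      using near par
    proof eventually_elim
      case (elim z)
      let ?q = "snd z"
      have q: "?q \<in> fst c" "?q \<in> W" using elim by auto
      have "D (snd c ?q) (X0 c ?q) = 0"
        using F_integral q dal[OF vector_fields(1) q] unfolding first_integral_on_def by simp
      then show ?case
        using dal[OF vector_fields(3)[of "fst z"] q] elim lin[of ?q]
        by (simp add: linear_cmul linear_diff divide_inverse mult.commute)
    qed
  qed
  then show ?thesis by (simp add: case_prod_unfold)
qed

text \<open>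
  Continuity comes for free from the joint limit: letting \<open>\<epsilon>\<close> tend to \<open>0\<close> first, at a point \<open>q\<close> near
  \<open>p\<close>, preserves the estimate against the value at \<open>p\<close>.
\<close>

lemma continuous_on_d_along: "continuous_on W (d_along A F X1)"
proof (rule continuous_at_imp_continuous_on, rule ballI)
  fix p assume p: "p \<in> W"
  let ?Q = "d_along A F X1"
  have "(?Q \<longlongrightarrow> ?Q p) (nhds p)"
  proof (rule tendstoI)
    fix r :: real assume "r > 0"
    have "eventually (\<lambda>z. dist (d_along A F (X (fst z)) (snd z) / fst z) (?Q p) < r / 2)
        (at_right 0 \<times>\<^sub>F nhds p)"
      using tendstoD[OF d_along_quotient_tendsto[OF p], of "r / 2"] \<open>r > 0\<close>
      by (simp add: case_prod_unfold)
    then obtain Pf Pg where Pf: "eventually Pf (at_right 0)" and Pg: "eventually Pg (nhds p)"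
      and *: "\<And>e q. Pf e \<Longrightarrow> Pg q \<Longrightarrow> dist (d_along A F (X e) q / e) (?Q p) < r / 2"
      unfolding eventually_prod_filter by auto
    have "eventually (\<lambda>q. q \<in> W) (nhds p)" using open_W p by (rule eventually_nhds_in_open)
    with Pg show "eventually (\<lambda>q. dist (?Q q) (?Q p) < r) (nhds p)"
    proof eventually_elim
      case (elim q)
      have "filterlim (\<lambda>e. (e, q)) (at_right (0::real) \<times>\<^sub>F nhds q) (at_right 0)"
        by (intro filterlim_Pair filterlim_ident tendsto_const)
      from filterlim_compose[OF d_along_quotient_tendsto[OF elim(2)] this]
      have "((\<lambda>e. dist (d_along A F (X e) q / e) (?Q p)) \<longlongrightarrow> dist (?Q q) (?Q p)) (at_right 0)"
        by (intro tendsto_intros) simp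
      then have "dist (?Q q) (?Q p) \<le> r / 2"
        by (rule tendsto_upperbound) (use Pf * elim in \<open>auto elim!: eventually_mono intro: less_imp_le\<close>)
      then show ?case using \<open>r > 0\<close> by simp
    qed
  qed
  then show "isCont ?Q p" unfolding isCont_def tendsto_at_iff_tendsto_nhds .
qed

end


section \<open>Uniqueness of orbits\<close>

lemma C1_imp_locally_Lipschitz:
  fixes h :: "'a::euclidean_space \<Rightarrow> 'b::real_normed_vector"
  assumes "open U" "u \<in> U"
    and der: "\<And>x. x \<in> U \<Longrightarrow> (h has_derivative h' x) (at x)"
    and cont: "\<And>v. continuous_on U (\<lambda>x. h' x v)"
  obtains r L where "r > 0" "L \<ge> 0" "cball u r \<subseteq> U"
    "\<And>x y. x \<in> cball u r \<Longrightarrow> y \<in> cball u r \<Longrightarrow> norm (h x - h y) \<le> L * norm (x - y)"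
proof -
  obtain r where r: "r > 0" "cball u r \<subseteq> U" using assms(1,2) open_contains_cball by blast
  have "continuous_on (cball u r) (\<lambda>x. \<Sum>b\<in>Basis. norm (h' x b))"
    by (intro continuous_intros continuous_on_subset[OF cont r(2)])
  then obtain L where L: "\<And>x. x \<in> cball u r \<Longrightarrow> (\<Sum>b\<in>Basis. norm (h' x b)) \<le> L"
    using continuous_attains_sup[of "cball u r" "\<lambda>x. \<Sum>b\<in>Basis. norm (h' x b)"] r(1)
    by (auto simp del: mem_cball)
  have "norm (h x - h y) \<le> L * norm (x - y)" if "x \<in> cball u r" "y \<in> cball u r" for x y
  proof (rule differentiable_bound[OF convex_cball _ _ that])
    fix z assume z: "z \<in> cball u r"
    with der r(2) have d: "(h has_derivative h' z) (at z)" by blast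
    then show "(h has_derivative h' z) (at z within cball u r)" by (rule has_derivative_at_withinI)
    show "onorm (h' z) \<le> L"
      using onorm_componentwise[OF has_derivative_bounded_linear[OF d]] L[OF z] by linarith
  qed
  moreover have "0 \<le> L" using L[of u] r(1) sum_nonneg[of Basis "\<lambda>b. norm (h' u b)"]
    by (metis centre_in_cball less_imp_le norm_ge_zero order_trans)
  ultimately show thesis using that r by blast
qed

text \<open>
  On an interval of length comparable to \<open>1 / L\<close> the maximum of the distance between two solutions
  is at most half of itself.
\<close>

lemma Lipschitz_ODE_unique_local:
  fixes h :: "'a::real_normed_vector \<Rightarrow> 'a" and t0 d :: real
  assumes "d > 0" "L \<ge> 0"
    and Lip: "\<And>x y. x \<in> B \<Longrightarrow> y \<in> B \<Longrightarrow> norm (h x - h y) \<le> L * norm (x - y)"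
    and u: "\<And>t. t \<in> cball t0 d \<Longrightarrow> u t \<in> B \<and> (u has_vector_derivative h (u t)) (at t)"
    and v: "\<And>t. t \<in> cball t0 d \<Longrightarrow> v t \<in> B \<and> (v has_vector_derivative h (v t)) (at t)"
    and "u t0 = v t0"
  shows "\<exists>e>0. \<forall>t\<in>cball t0 e. u t = v t"
proof -
  define e where "e = min d (1 / (2 * L + 1))"
  have e: "e > 0" "e \<le> d" "L * e \<le> 1 / 2"
    using assms(1,2) by (auto simp: e_def min_def field_simps)
  let ?w = "\<lambda>t. u t - v t"
  have w: "(?w has_vector_derivative h (u t) - h (v t)) (at t within cball t0 e)"
    if "t \<in> cball t0 e" for t
    using u[of t] v[of t] that e
    by (auto intro!: has_vector_derivative_diff intro: has_vector_derivative_at_within)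
  have "continuous_on (cball t0 e) (\<lambda>t. norm (?w t))"
    using has_vector_derivative_continuous[OF w]
    by (intro continuous_on_norm) (simp add: continuous_on_eq_continuous_within)
  then obtain t1 where t1: "t1 \<in> cball t0 e" "\<And>t. t \<in> cball t0 e \<Longrightarrow> norm (?w t) \<le> norm (?w t1)"
    using continuous_attains_sup[of "cball t0 e" "\<lambda>t. norm (?w t)"] e(1) by auto
  have "norm (?w t1 - ?w t0 - (t1 - t0) *\<^sub>R (h (u t0) - h (v t0))) \<le> norm (t1 - t0) * (L * norm (?w t1))"
  proof (rule vector_differentiable_bound_linearization[OF w])
    show "closed_segment t0 t1 \<subseteq> cball t0 e"
      using t1(1) e(1) by (intro closed_segment_subset) auto
    fix t assume t: "t \<in> cball t0 e"
    have "norm (h (u t) - h (v t)) \<le> L * norm (?w t)"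
      using Lip u[of t] v[of t] t e by auto
    also have "\<dots> \<le> L * norm (?w t1)" using t1(2)[OF t] assms(2) by (rule mult_left_mono)
    finally show "norm (h (u t) - h (v t) - (h (u t0) - h (v t0))) \<le> L * norm (?w t1)"
      using assms(6) by simp
  qed (use e in auto)
  also have "\<dots> \<le> e * (L * norm (?w t1))"
    using t1(1) assms(2) by (intro mult_right_mono) (auto simp: dist_norm norm_minus_commute)
  also have "\<dots> = L * e * norm (?w t1)" by simp
  also have "\<dots> \<le> 1 / 2 * norm (?w t1)" using e(3) by (intro mult_right_mono) auto
  finally have "norm (?w t1) \<le> 1 / 2 * norm (?w t1)" using assms(6) by simp
  then have "norm (?w t1) = 0" by simp
  with t1(2) e(1) show ?thesis by (intro exI[of _ e]) force
qed

lemma integral_curve_shift: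
  assumes "integral_curve A Y \<gamma>"
  shows "integral_curve A Y (\<lambda>t. \<gamma> (t + s))"
  unfolding integral_curve_def
proof (intro conjI allI ballI impI)
  have cont: "continuous_on UNIV \<gamma>" using assms unfolding integral_curve_def by auto
  show "continuous_on UNIV (\<lambda>t. \<gamma> (t + s))"
    by (rule continuous_on_compose2[OF cont]) (auto intro!: continuous_intros)
  fix t c assume c: "c \<in> A" "\<gamma> (t + s) \<in> fst c"
  have "((\<lambda>t. t + s) has_vector_derivative 1) (at t)"
    by (auto intro!: derivative_eq_intros)
  moreover have "((snd c \<circ> \<gamma>) has_vector_derivative Y c (\<gamma> (t + s))) (at (t + s))"
    using assms c unfolding integral_curve_def by auto
  ultimately have "((snd c \<circ> \<gamma>) \<circ> (\<lambda>t. t + s) has_vector_derivative 1 *\<^sub>R Y c (\<gamma> (t + s))) (at t)"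
    by (rule vector_diff_chain_at)
  then show "((snd c \<circ> (\<lambda>t. \<gamma> (t + s))) has_vector_derivative Y c (\<gamma> (t + s))) (at t)"
    by (simp add: o_def)
qed

context perturbed_first_integral
begin

lemma unperturbed_field_C1:
  assumes "c \<in> A"
  obtains h' where
    "\<And>u. u \<in> snd c ` fst c \<Longrightarrow> ((\<lambda>u. X0 c (chart_inv c u)) has_derivative h' u) (at u)"
    "\<And>v. continuous_on (snd c ` fst c) (\<lambda>u. h' u v)"
proof -
  let ?U = "snd c ` fst c" and ?g = "\<lambda>(u, \<epsilon>). X \<epsilon> c (chart_inv c u)"
  have "Ck_on (Suc (Suc 0)) ?g (?U \<times> {0..<\<epsilon>0})"
    using field_family assms unfolding C2_field_family_def by (auto simp: numeral_2_eq_2)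
  then obtain g' where
    g': "\<And>x. x \<in> ?U \<times> {0..<\<epsilon>0} \<Longrightarrow> (?g has_derivative g' x) (at x within ?U \<times> {0..<\<epsilon>0})"
    and cont: "\<And>v. continuous_on (?U \<times> {0..<\<epsilon>0}) (\<lambda>x. g' x v)"
    by (rule Ck_on_SucE) (rule that)
  note open_U = open_chart_image[OF manifold assms]
  show thesis
  proof (rule that[of "\<lambda>u v. g' (u, 0) (v, 0)"])
    fix u assume u: "u \<in> ?U"
    have "((\<lambda>u. (u, 0)) has_derivative (\<lambda>v. (v, 0::real))) (at u within ?U)"
      by (auto intro!: derivative_eq_intros)
    moreover have "(?g has_derivative g' (u, 0)) (at (u, 0) within (\<lambda>u. (u, 0)) ` ?U)"
      by (rule has_derivative_subset[OF g']) (use u \<epsilon>0_pos in auto)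
    ultimately have "(?g \<circ> (\<lambda>u. (u, 0)) has_derivative g' (u, 0) \<circ> (\<lambda>v. (v, 0))) (at u within ?U)"
      by (rule diff_chain_within)
    then have "((\<lambda>u. X 0 c (chart_inv c u)) has_derivative (\<lambda>v. g' (u, 0) (v, 0))) (at u)"
      using at_within_open[OF u open_U] by (simp add: o_def)
    then show "((\<lambda>u. X0 c (chart_inv c u)) has_derivative (\<lambda>v. g' (u, 0) (v, 0))) (at u)"
      by (rule has_derivative_transform_within_open[OF _ open_U u])
        (auto simp: chart_inv_chart[OF manifold assms] field_at_zero[OF assms])
  next
    fix v
    show "continuous_on ?U (\<lambda>u. g' (u, 0) (v, 0))"
      by (rule continuous_on_compose2[OF cont]) (use \<epsilon>0_pos in \<open>auto intro!: continuous_intros\<close>)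
  qed
qed

text \<open>
  The set of times at which the two orbits agree is closed, since the manifold is Hausdorff, and
  open, by local uniqueness in a chart.
\<close>

lemma unperturbed_curve_unique:
  assumes "integral_curve A X0 \<alpha>" "integral_curve A X0 \<beta>" "\<alpha> s = \<beta> s"
  shows "\<alpha> = \<beta>"
proof -
  have cont: "continuous_on UNIV \<alpha>" "continuous_on UNIV \<beta>"
    using assms unfolding integral_curve_def by auto
  define S where "S = {t. \<alpha> t = \<beta> t}"
  have "closed S" unfolding S_def using cont by (rule closed_Collect_eq)
  moreover have "open S"
    unfolding open_contains_cball
  proof
    fix t0 assume "t0 \<in> S"
    then have t0: "\<alpha> t0 = \<beta> t0" by (simp add: S_def)
    obtain c where c: "c \<in> A" "\<alpha> t0 \<in> fst c" by (rule chart_around[OF manifold])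
    let ?U = "snd c ` fst c" and ?u = "snd c (\<alpha> t0)" and ?h = "\<lambda>u. X0 c (chart_inv c u)"
    note inv = chart_inv_chart[OF manifold c(1)]
    obtain h' where h': "\<And>u. u \<in> ?U \<Longrightarrow> (?h has_derivative h' u) (at u)"
      "\<And>v. continuous_on ?U (\<lambda>u. h' u v)"
      by (rule unperturbed_field_C1[OF c(1)]) (rule that)
    have "?u \<in> ?U" using c by auto
    obtain r L where rL: "r > 0" "L \<ge> 0" "cball ?u r \<subseteq> ?U"
      "\<And>x y. x \<in> cball ?u r \<Longrightarrow> y \<in> cball ?u r \<Longrightarrow> norm (?h x - ?h y) \<le> L * norm (x - y)"
      by (rule C1_imp_locally_Lipschitz[OF open_chart_image[OF manifold c(1)] \<open>?u \<in> ?U\<close> h'])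
        (auto intro: that)
    define V where "V = snd c -` ball ?u r \<inter> fst c"
    have "open V"
      unfolding V_def using continuous_on_chart[OF manifold c(1)] open_chart_domain[OF manifold c(1)]
      by (simp add: continuous_on_open_vimage)
    then have "open (\<alpha> -` V \<inter> \<beta> -` V)" using cont by (intro open_Int open_vimage)
    moreover have "t0 \<in> \<alpha> -` V \<inter> \<beta> -` V" using c t0 rL(1) by (auto simp: V_def)
    ultimately obtain d where d: "d > 0" "cball t0 d \<subseteq> \<alpha> -` V \<inter> \<beta> -` V"
      unfolding open_contains_cball by blast
    have sol: "(snd c \<circ> \<gamma>) t \<in> cball ?u r \<and>
        ((snd c \<circ> \<gamma>) has_vector_derivative ?h ((snd c \<circ> \<gamma>) t)) (at t)"
      if "integral_curve A X0 \<gamma>" "\<gamma> t \<in> V" for \<gamma> t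
      using that c inv unfolding integral_curve_def V_def by auto
    have "\<exists>e>0. \<forall>t\<in>cball t0 e. (snd c \<circ> \<alpha>) t = (snd c \<circ> \<beta>) t"
    proof (rule Lipschitz_ODE_unique_local[OF d(1) rL(2,4), where u = "snd c \<circ> \<alpha>" and v = "snd c \<circ> \<beta>"])
      fix t assume "t \<in> cball t0 d"
      then have "\<alpha> t \<in> V" "\<beta> t \<in> V" using d(2) by auto
      from \<open>\<alpha> t \<in> V\<close> show "(snd c \<circ> \<alpha>) t \<in> cball ?u r \<and>
          ((snd c \<circ> \<alpha>) has_vector_derivative ?h ((snd c \<circ> \<alpha>) t)) (at t)"
        by (rule sol[OF assms(1)])
      from \<open>\<beta> t \<in> V\<close> show "(snd c \<circ> \<beta>) t \<in> cball ?u r \<and>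
          ((snd c \<circ> \<beta>) has_vector_derivative ?h ((snd c \<circ> \<beta>) t)) (at t)"
        by (rule sol[OF assms(2)])
    qed (use t0 in auto)
    then obtain e where e: "e > 0" "\<And>t. t \<in> cball t0 e \<Longrightarrow> snd c (\<alpha> t) = snd c (\<beta> t)" by auto
    have "\<alpha> t = \<beta> t" if "t \<in> cball t0 (min d e)" for t
    proof -
      have "\<alpha> t \<in> fst c" "\<beta> t \<in> fst c" using that d(2) by (auto simp: V_def)
      moreover have "snd c (\<alpha> t) = snd c (\<beta> t)" using e(2) that by auto
      ultimately show ?thesis using inv by metis
    qed
    then show "\<exists>e>0. cball t0 e \<subseteq> S"
      using d(1) e(1) by (intro exI[of _ "min d e"]) (auto simp: S_def)
  qed
  ultimately have "S = {} \<or> S = UNIV" using clopen by blast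
  then show ?thesis using assms(3) unfolding S_def by auto
qed

end


section \<open>The increment of the first integral along perturbed orbits\<close>

text \<open>
  The family of periodic orbits and the family of homoclinic orbits are both instances. That
  \<open>\<gamma> 0\<close> is an orbit of \<open>X0\<close> is stated separately, because the field \<open>X 0\<close> need only agree with
  \<open>X0\<close> in the charts of the atlas.
\<close>

locale perturbed_curves = perturbed_first_integral A X X0 X1 \<epsilon>0 F W
  for A :: "('m::t2_space, 'n::finite) chart set"
    and X :: "real \<Rightarrow> ('m, 'n) field" and X0 X1 :: "('m, 'n) field"
    and \<epsilon>0 :: real and F :: "'m \<Rightarrow> real" and W :: "'m set" +
  fixes \<gamma> :: "real \<Rightarrow> real \<Rightarrow> 'm"
  assumes continuous_curves: "continuous_on ({0..<\<epsilon>0} \<times> UNIV) (\<lambda>(\<epsilon>, t). \<gamma> \<epsilon> t)"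
    and integral_curves: "\<epsilon> \<in> {0..<\<epsilon>0} \<Longrightarrow> integral_curve A (X \<epsilon>) (\<gamma> \<epsilon>)"
    and unperturbed_curve: "integral_curve A X0 (\<gamma> 0)"
    and in_W: "\<gamma> 0 t \<in> W"
begin

abbreviation melnikov :: "real \<Rightarrow> real" where
  "melnikov t \<equiv> d_along A F X1 (\<gamma> 0 t)"

definition primitive :: "real \<Rightarrow> real" where
  "primitive = (SOME J. \<forall>t. (J has_vector_derivative melnikov t) (at t))"

lemma continuous_on_melnikov: "continuous_on UNIV melnikov"
  using unperturbed_curve in_W unfolding integral_curve_def
  by (intro continuous_on_compose2[OF continuous_on_d_along]) auto

lemma primitive_derivative: "(primitive has_vector_derivative melnikov t) (at t)"
proof -
  have "\<exists>J. \<forall>t::real. - \<infinity> < ereal t \<longrightarrow> ereal t < \<infinity> \<longrightarrow> (J has_vector_derivative melnikov t) (at t)"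
    by (rule einterval_antiderivative) (use continuous_on_melnikov in \<open>auto simp: continuous_on_eq_continuous_at\<close>)
  then have "\<exists>J. \<forall>t. (J has_vector_derivative melnikov t) (at t)" by auto
  from someI_ex[OF this] show ?thesis unfolding primitive_def by blast
qed

lemma continuous_on_primitive: "continuous_on S primitive"
  using has_vector_derivative_continuous[OF has_vector_derivative_at_within[OF primitive_derivative]]
  by (simp add: continuous_on_eq_continuous_within)

lemma melnikov_has_integral:
  assumes "a \<le> b"
  shows "(melnikov has_integral (primitive b - primitive a)) {a..b}"
  using assms by (rule fundamental_theorem_of_calculus)
    (rule has_vector_derivative_at_within[OF primitive_derivative])

lemma curves_tendsto: "((\<lambda>z. \<gamma> (fst z) (snd z)) \<longlongrightarrow> \<gamma> 0 t) (at_right 0 \<times>\<^sub>F nhds t)"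
  using tendsto_prod_at_right[OF continuous_curves open_UNIV UNIV_I \<epsilon>0_pos]
  by (simp add: case_prod_unfold)

lemma F_conserved: "F (\<gamma> 0 s) = F (\<gamma> 0 t)"
proof -
  have "((\<lambda>t. F (\<gamma> 0 t)) has_vector_derivative 0) (at t within UNIV)" for t
    using has_derivative_along_integral_curve[OF manifold F_Suc open_W vector_fields(1) unperturbed_curve in_W, of t]
      F_integral in_W[of t] unfolding first_integral_on_def by simp
  from has_vector_derivative_zero_constant[OF convex_UNIV this] show ?thesis by (metis UNIV_I)
qed

text \<open>
  Along a perturbed orbit \<open>F - \<epsilon> J\<close> has derivative \<open>dF(X \<epsilon>) - \<epsilon> Q = o(\<epsilon>)\<close>, uniformly on a compact
  time interval.
\<close>

lemma F_increment_uniform: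
  assumes "\<eta> > 0"
  shows "eventually (\<lambda>\<epsilon>. \<forall>s\<in>{a..b}. \<forall>t\<in>{a..b}.
      \<bar>F (\<gamma> \<epsilon> t) - F (\<gamma> \<epsilon> s) - \<epsilon> * (primitive t - primitive s)\<bar> \<le> \<epsilon> * \<eta>) (at_right 0)"
proof (cases "a \<le> b")
  case True
  \<comment> \<open>The summand \<open>1\<close> avoids division by zero for \<open>a = b\<close>.\<close>
  define \<kappa> where "\<kappa> = \<eta> / (b - a + 1)"
  have \<kappa>: "\<kappa> > 0" using True assms by (simp add: \<kappa>_def)
  let ?D = "\<lambda>\<epsilon> t. d_along A F (X \<epsilon>) (\<gamma> \<epsilon> t)"
  have "eventually (\<lambda>\<epsilon>. \<forall>t\<in>{a..b}. \<gamma> \<epsilon> t \<in> W \<and> dist (?D \<epsilon> t / \<epsilon>) (melnikov t) < \<kappa>) (at_right 0)"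
  proof (rule eventually_ball_compact[OF compact_Icc])
    fix t :: real
    let ?F = "at_right 0 \<times>\<^sub>F nhds t"
    have "eventually (\<lambda>z. \<gamma> (fst z) (snd z) \<in> W) ?F"
      using curves_tendsto open_W in_W by (rule topological_tendstoD)
    moreover have "eventually (\<lambda>z. dist (?D (fst z) (snd z) / fst z) (melnikov (snd z)) < \<kappa>) ?F"
    proof -
      have "filterlim (\<lambda>z. (fst z, \<gamma> (fst z) (snd z))) (at_right 0 \<times>\<^sub>F nhds (\<gamma> 0 t)) ?F"
        by (intro filterlim_Pair filterlim_fst curves_tendsto)
      from filterlim_compose[OF d_along_quotient_tendsto[OF in_W] this]
      have "((\<lambda>z. ?D (fst z) (snd z) / fst z) \<longlongrightarrow> melnikov t) ?F" by simp
      moreover have "isCont melnikov t"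
        using continuous_on_melnikov by (auto simp: continuous_on_eq_continuous_at)
      then have "(melnikov \<longlongrightarrow> melnikov t) (nhds t)"
        unfolding isCont_def tendsto_at_iff_tendsto_nhds[of melnikov] .
      then have "((\<lambda>z. melnikov (snd z)) \<longlongrightarrow> melnikov t) ?F"
        by (rule filterlim_compose[OF _ filterlim_snd])
      ultimately have "((\<lambda>z. dist (?D (fst z) (snd z) / fst z) (melnikov (snd z))) \<longlongrightarrow>
          dist (melnikov t) (melnikov t)) ?F"
        by (rule tendsto_dist)
      then show ?thesis using \<kappa> by (intro order_tendstoD(2)) auto
    qed
    ultimately show "eventually (\<lambda>(\<epsilon>, t). \<gamma> \<epsilon> t \<in> W \<and> dist (?D \<epsilon> t / \<epsilon>) (melnikov t) < \<kappa>) ?F"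
      by eventually_elim auto
  qed
  then show ?thesis
    using eventually_parameter
  proof eventually_elim
    case (elim \<epsilon>)
    then have \<epsilon>: "0 < \<epsilon>" "\<epsilon> \<in> {0..<\<epsilon>0}" by auto
    have "norm ((F (\<gamma> \<epsilon> t) - \<epsilon> * primitive t) - (F (\<gamma> \<epsilon> s) - \<epsilon> * primitive s)) \<le> \<epsilon> * \<kappa> * norm (t - s)"
      if st: "s \<in> {a..b}" "t \<in> {a..b}" for s t
    proof (rule field_differentiable_bound[OF convex_real_interval(5) _ _ st(2,1)])
      fix r assume r: "r \<in> {a..b}"
      have "((\<lambda>t. F (\<gamma> \<epsilon> t)) has_vector_derivative ?D \<epsilon> r) (at r)"
        by (rule has_derivative_along_integral_curve[OF manifold F_Suc open_W vector_fields(3)[OF \<epsilon>(2)]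
              integral_curves[OF \<epsilon>(2)]]) (use elim r in auto)
      then have "((\<lambda>t. F (\<gamma> \<epsilon> t) - \<epsilon> * primitive t) has_vector_derivative ?D \<epsilon> r - \<epsilon> * melnikov r) (at r)"
        by (intro has_vector_derivative_diff has_vector_derivative_mult_right primitive_derivative)
      then show "((\<lambda>t. F (\<gamma> \<epsilon> t) - \<epsilon> * primitive t) has_field_derivative ?D \<epsilon> r - \<epsilon> * melnikov r)
          (at r within {a..b})"
        by (simp add: has_real_derivative_iff_has_vector_derivative has_vector_derivative_at_within)
      have "\<bar>?D \<epsilon> r / \<epsilon> - melnikov r\<bar> \<le> \<kappa>"
        using elim r by (auto simp: dist_real_def intro: less_imp_le)
      then have "\<epsilon> * \<bar>?D \<epsilon> r / \<epsilon> - melnikov r\<bar> \<le> \<epsilon> * \<kappa>" using \<epsilon>(1) by simp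
      moreover have "\<epsilon> * \<bar>?D \<epsilon> r / \<epsilon> - melnikov r\<bar> = \<bar>\<epsilon> * (?D \<epsilon> r / \<epsilon> - melnikov r)\<bar>"
        using \<epsilon>(1) by (simp add: abs_mult)
      moreover have "\<epsilon> * (?D \<epsilon> r / \<epsilon> - melnikov r) = ?D \<epsilon> r - \<epsilon> * melnikov r"
        using \<epsilon>(1) by (simp add: field_simps)
      ultimately show "norm (?D \<epsilon> r - \<epsilon> * melnikov r) \<le> \<epsilon> * \<kappa>" by simp
    qed
    moreover have "\<epsilon> * \<kappa> * norm (t - s) \<le> \<epsilon> * \<eta>" if "s \<in> {a..b}" "t \<in> {a..b}" for s t
    proof -
      have "norm (t - s) \<le> b - a + 1" using that by auto
      then have "\<kappa> * norm (t - s) \<le> \<kappa> * (b - a + 1)" using \<kappa> by (intro mult_left_mono) auto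
      also have "\<dots> = \<eta>" using True by (simp add: \<kappa>_def)
      finally show ?thesis using \<epsilon>(1) by (simp add: mult.assoc)
    qed
    ultimately show ?case by (smt (verit, best) real_norm_def right_diff_distrib)
  qed
qed simp

text \<open>
  The end points may depend on \<open>\<epsilon>\<close>. This covers both a period that varies with \<open>\<epsilon>\<close> and a
  reparametrisation of time.
\<close>

lemma F_increment_quotient_tendsto:
  assumes "(\<alpha> \<longlongrightarrow> s) (at_right 0)" "(\<beta> \<longlongrightarrow> t) (at_right 0)"
  shows "((\<lambda>\<epsilon>. (F (\<gamma> \<epsilon> (\<beta> \<epsilon>)) - F (\<gamma> \<epsilon> (\<alpha> \<epsilon>))) / \<epsilon>) \<longlongrightarrow> primitive t - primitive s) (at_right 0)"
proof -
  define a b where "a = min s t - 1" and "b = max s t + 1"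
  let ?q = "\<lambda>\<epsilon>. (F (\<gamma> \<epsilon> (\<beta> \<epsilon>)) - F (\<gamma> \<epsilon> (\<alpha> \<epsilon>))) / \<epsilon>"
    and ?p = "\<lambda>\<epsilon>. primitive (\<beta> \<epsilon>) - primitive (\<alpha> \<epsilon>)"
  have ev: "eventually (\<lambda>\<epsilon>. \<alpha> \<epsilon> \<in> {a<..<b}) (at_right 0)" "eventually (\<lambda>\<epsilon>. \<beta> \<epsilon> \<in> {a<..<b}) (at_right 0)"
    using topological_tendstoD[OF assms(1), of "{a<..<b}"] topological_tendstoD[OF assms(2), of "{a<..<b}"]
    by (simp_all add: a_def b_def min_def max_def split: if_splits)
  have "((\<lambda>\<epsilon>. ?q \<epsilon> - ?p \<epsilon>) \<longlongrightarrow> 0) (at_right 0)"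
  proof (rule tendstoI)
    fix r :: real assume "r > 0"
    then have "r / 2 > 0" by simp
    from F_increment_uniform[OF this, of a b] ev eventually_at_right_less[of 0]
    show "eventually (\<lambda>\<epsilon>. dist (?q \<epsilon> - ?p \<epsilon>) 0 < r) (at_right 0)"
    proof eventually_elim
      case (elim \<epsilon>)
      let ?d = "F (\<gamma> \<epsilon> (\<beta> \<epsilon>)) - F (\<gamma> \<epsilon> (\<alpha> \<epsilon>)) - \<epsilon> * ?p \<epsilon>"
      have "\<bar>?d\<bar> \<le> \<epsilon> * (r / 2)" using elim by auto
      moreover have "?q \<epsilon> - ?p \<epsilon> = ?d / \<epsilon>" using elim by (simp add: field_simps)
      ultimately have "\<bar>?q \<epsilon> - ?p \<epsilon>\<bar> \<le> r / 2" using elim by (simp add: field_simps)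
      then show ?case using \<open>r > 0\<close> by (simp add: dist_real_def)
    qed
  qed
  moreover have "isCont primitive x" for x
    using continuous_on_primitive[of UNIV] by (simp add: continuous_on_eq_continuous_at)
  then have "(?p \<longlongrightarrow> primitive t - primitive s) (at_right 0)"
    using assms by (intro tendsto_diff isCont_tendsto_compose[where g = primitive])
  ultimately have "((\<lambda>\<epsilon>. ?q \<epsilon> - ?p \<epsilon> + ?p \<epsilon>) \<longlongrightarrow> 0 + (primitive t - primitive s)) (at_right 0)"
    by (rule tendsto_add)
  then show ?thesis by simp
qed

end


section \<open>Expansions uniform over families of curves\<close>

lemma curve_increment_bound:
  fixes w :: "real \<Rightarrow> 'a::real_normed_vector"
  assumes "\<And>e. e \<in> S \<Longrightarrow> (w has_vector_derivative w' e) (at e within S)"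
    "\<And>e. e \<in> S \<Longrightarrow> norm (w' e) \<le> B" "convex S" "x \<in> S" "y \<in> S"
  shows "norm (w x - w y) \<le> B * norm (x - y)"
proof (rule differentiable_bound[OF assms(3) _ _ assms(4,5)])
  fix e assume e: "e \<in> S"
  show "(w has_derivative (\<lambda>h. h *\<^sub>R w' e)) (at e within S)"
    using assms(1)[OF e] unfolding has_vector_derivative_def .
  show "onorm (\<lambda>h. h *\<^sub>R w' e) \<le> B"
    by (rule onorm_le) (use assms(2)[OF e] in \<open>simp add: mult.commute[of B] mult_left_mono\<close>)
qed

lemma linear_functional_oscillation:
  fixes L :: "'a::euclidean_space \<Rightarrow> 'a \<Rightarrow> real"
  assumes "open U" "u0 \<in> U" "\<kappa> > 0"
    and lin: "\<And>x. x \<in> U \<Longrightarrow> linear (L x)"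
    and cont: "\<And>v. continuous_on U (\<lambda>x. L x v)"
  obtains \<rho> where "\<rho> > 0" "cball u0 \<rho> \<subseteq> U"
    "\<And>x v. x \<in> cball u0 \<rho> \<Longrightarrow> \<bar>L x v - L u0 v\<bar> \<le> \<kappa> * norm v"
proof -
  let ?S = "\<lambda>x. \<Sum>b\<in>Basis. norm (L x b - L u0 b)"
  have "continuous_on U ?S" by (intro continuous_intros cont)
  then obtain r where r: "r > 0" "\<And>x. x \<in> U \<Longrightarrow> dist x u0 < r \<Longrightarrow> dist (?S x) (?S u0) < \<kappa>"
    using assms(2,3) unfolding continuous_on_iff by blast
  obtain q where q: "q > 0" "cball u0 q \<subseteq> U" using assms(1,2) open_contains_cball by blast
  show thesis
  proof (rule that[of "min q (r / 2)"])
    fix x v assume x: "x \<in> cball u0 (min q (r / 2))"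
    then have xU: "x \<in> U" and "dist x u0 < r" using q r(1) by (auto simp: dist_commute)
    then have S: "?S x \<le> \<kappa>" using r(2)[of x] by (simp add: dist_real_def sum_nonneg)
    have "linear (\<lambda>v. L x v - L u0 v)" using lin[OF xU] lin[OF assms(2)] by (rule linear_compose_sub)
    then have bl: "bounded_linear (\<lambda>v. L x v - L u0 v)" by (simp add: linear_conv_bounded_linear)
    have "norm (L x v - L u0 v) \<le> onorm (\<lambda>v. L x v - L u0 v) * norm v" by (rule onorm[OF bl])
    also have "\<dots> \<le> \<kappa> * norm v"
      using onorm_componentwise[OF bl] S by (intro mult_right_mono) auto
    finally show "\<bar>L x v - L u0 v\<bar> \<le> \<kappa> * norm v" by simp
  qed (use q r in auto)
qed

text \<open>
  The numbers \<open>\<rho>\<close> and \<open>\<delta>\<close> do not depend on the curve \<open>u\<close>: the derivative of \<open>f \<circ> u\<close> is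
  \<open>f' (u x) (D1 x)\<close>, where \<open>f'\<close> hardly varies near \<open>u0\<close> and \<open>D1\<close> varies at the bounded rate \<open>D2\<close>.
\<close>

lemma uniform_first_order_expansion:
  fixes f :: "'a::euclidean_space \<Rightarrow> real"
  assumes "open U" "u0 \<in> U" "\<eta> > 0" "B > 0"
    and der: "\<And>x. x \<in> U \<Longrightarrow> (f has_derivative f' x) (at x)"
    and cont: "\<And>v. continuous_on U (\<lambda>x. f' x v)"
  obtains \<rho> \<delta> where "\<rho> > 0" "\<delta> > 0" "cball u0 \<rho> \<subseteq> U"
    "\<And>u D1 D2 d e. u 0 \<in> cball u0 (\<rho> / 2) \<Longrightarrow>
       \<forall>x\<in>{0..<d}. (u has_vector_derivative D1 x) (at x within {0..<d}) \<and>
          (D1 has_vector_derivative D2 x) (at x within {0..<d}) \<and> norm (D1 x) \<le> B \<and> norm (D2 x) \<le> B \<Longrightarrow>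
       0 < e \<Longrightarrow> e < d \<Longrightarrow> e < \<delta> \<Longrightarrow>
       u e \<in> cball u0 \<rho> \<and> \<bar>f (u e) - f (u 0) - e * f' (u 0) (D1 0)\<bar> \<le> e * \<eta>"
proof -
  have lin: "linear (f' x)" if "x \<in> U" for x
    using der[OF that] by (rule has_derivative_linear)
  have "\<eta> / (4 * B) > 0" using assms by simp
  from linear_functional_oscillation[OF assms(1,2) this lin cont]
  obtain \<rho> where \<rho>: "\<rho> > 0" "cball u0 \<rho> \<subseteq> U"
    and osc: "\<And>x v. x \<in> cball u0 \<rho> \<Longrightarrow> \<bar>f' x v - f' u0 v\<bar> \<le> \<eta> / (4 * B) * norm v" by blast
  from linear_bounded_pos[OF lin[OF assms(2)]]
  obtain M where M: "M > 0" "\<And>v. norm (f' u0 v) \<le> M * norm v" by blast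
  \<comment> \<open>The first bound keeps \<open>u\<close> in the ball of radius \<open>\<rho>\<close>, the second limits the effect of the change
    of \<open>D1\<close> to \<open>\<eta> / 2\<close>.\<close>
  define \<delta> where "\<delta> = min (\<rho> / (2 * B)) (\<eta> / (2 * M * B))"
  have \<delta>: "\<delta> > 0" "B * \<delta> \<le> \<rho> / 2" "M * (B * \<delta>) \<le> \<eta> / 2"
    using \<rho>(1) M(1) assms(3,4) by (auto simp: \<delta>_def min_def field_simps)
  show thesis
  proof (rule that[OF \<rho>(1) \<delta>(1) \<rho>(2)])
    fix u :: "real \<Rightarrow> 'a" and D1 D2 d e
    assume u0: "u 0 \<in> cball u0 (\<rho> / 2)" and e: "0 < e" "e < d" "e < \<delta>"
      and "\<forall>x\<in>{0..<d}. (u has_vector_derivative D1 x) (at x within {0..<d}) \<and>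
          (D1 has_vector_derivative D2 x) (at x within {0..<d}) \<and> norm (D1 x) \<le> B \<and> norm (D2 x) \<le> B"
    note D = this(5)[rule_format]
    have inc: "norm (u x - u 0) \<le> B * \<delta>" "norm (D1 x - D1 0) \<le> B * \<delta>" if "x \<in> {0..e}" for x
    proof -
      have "B * norm (x - 0) \<le> B * \<delta>" using that e assms(4) by (intro mult_left_mono) auto
      moreover have "norm (u x - u 0) \<le> B * norm (x - 0)"
        by (rule curve_increment_bound[of "{0..<d}" _ D1]) (use D that e in auto)
      moreover have "norm (D1 x - D1 0) \<le> B * norm (x - 0)"
        by (rule curve_increment_bound[of "{0..<d}" _ D2]) (use D that e in auto)
      ultimately show "norm (u x - u 0) \<le> B * \<delta>" "norm (D1 x - D1 0) \<le> B * \<delta>" by linarith+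
    qed
    have mem: "u x \<in> cball u0 \<rho>" if "x \<in> {0..e}" for x
    proof -
      have "dist u0 (u x) \<le> dist u0 (u 0) + dist (u 0) (u x)" by (rule dist_triangle)
      moreover have "dist (u 0) (u x) \<le> \<rho> / 2"
        using inc(1)[OF that] \<delta>(2) by (simp add: dist_norm norm_minus_commute)
      ultimately show ?thesis using u0 by simp
    qed
    have "norm ((f \<circ> u) e - (f \<circ> u) 0 - (e - 0) *\<^sub>R f' (u 0) (D1 0)) \<le> norm (e - 0) * \<eta>"
    proof (rule vector_differentiable_bound_linearization[where S = "{0..e}" and f' = "\<lambda>x. f' (u x) (D1 x)"])
      fix x assume x: "x \<in> {0..e}"
      have "(u has_vector_derivative D1 x) (at x within {0..e})"
        by (rule has_vector_derivative_within_subset[of _ _ _ "{0..<d}"]) (use D[of x] x e in auto)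
      moreover have "(f has_derivative f' (u x)) (at (u x) within u ` {0..e})"
        using der mem[OF x] \<rho>(2) by (blast intro: has_derivative_at_withinI)
      ultimately show "((f \<circ> u) has_vector_derivative f' (u x) (D1 x)) (at x within {0..e})"
        by (rule vector_derivative_diff_chain_within)
      have "norm (D1 x) \<le> B" "norm (D1 0) \<le> B" using D[of x] D[of 0] x e by auto
      then have "\<eta> / (4 * B) * norm (D1 x) \<le> \<eta> / (4 * B) * B" "\<eta> / (4 * B) * norm (D1 0) \<le> \<eta> / (4 * B) * B"
        by (intro mult_left_mono; use assms(3,4) in simp)+
      then have 1: "\<bar>f' (u x) (D1 x) - f' u0 (D1 x)\<bar> \<le> \<eta> / 4" "\<bar>f' (u 0) (D1 0) - f' u0 (D1 0)\<bar> \<le> \<eta> / 4"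
        using osc[OF mem[OF x], of "D1 x"] osc[OF mem[of 0], of "D1 0"] assms(4) e by auto
      have "norm (f' u0 (D1 x - D1 0)) \<le> M * norm (D1 x - D1 0)" by (rule M(2))
      also have "\<dots> \<le> M * (B * \<delta>)" using inc(2)[OF x] M(1) by (intro mult_left_mono) auto
      finally have "\<bar>f' u0 (D1 x) - f' u0 (D1 0)\<bar> \<le> \<eta> / 2"
        using \<delta>(3) linear_diff[OF lin[OF assms(2)]] by simp
      with 1 show "norm (f' (u x) (D1 x) - f' (u 0) (D1 0)) \<le> \<eta>"
        unfolding real_norm_def by linarith
    qed (use e in \<open>auto simp: closed_segment_eq_real_ivl\<close>)
    with mem[of e] e show "u e \<in> cball u0 \<rho> \<and> \<bar>f (u e) - f (u 0) - e * f' (u 0) (D1 0)\<bar> \<le> e * \<eta>"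
      by simp
  qed
qed

section \<open>Families of periodic orbits\<close>

lemma periodic_reduce:
  fixes f :: "real \<Rightarrow> 'a"
  assumes periodic: "\<And>t. f (t + P) = f t" and "P > 0"
  shows "\<exists>y\<in>{0..<P}. f x = f y"
proof -
  have period_nat: "f (t + of_nat n * P) = f t" for t and n :: nat
  proof (induction n)
    case (Suc n)
    have "t + of_nat (Suc n) * P = t + of_nat n * P + P" by (simp add: algebra_simps)
    then show ?case using periodic[of "t + of_nat n * P"] Suc by (simp only:)
  qed simp
  define y where "y = x - of_int \<lfloor>x / P\<rfloor> * P"
  have y: "y \<in> {0..<P}"
    using assms(2) floor_divide_lower[OF assms(2), of x] floor_divide_upper[OF assms(2), of x]
    by (auto simp: y_def algebra_simps)
  have "f x = f y"
  proof (cases "\<lfloor>x / P\<rfloor> \<ge> 0")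
    case True
    then show ?thesis using period_nat[of y "nat \<lfloor>x / P\<rfloor>"] by (simp add: y_def)
  next
    case False
    then show ?thesis using period_nat[of x "nat (- \<lfloor>x / P\<rfloor>)"] by (simp add: y_def)
  qed
  with y show ?thesis by blast
qed

context perturbed_curves
begin

text \<open>
  Over one perturbed period the increment of \<open>F\<close> vanishes exactly; its first-order term is the
  increment of the primitive over the limiting period.
\<close>

lemma primitive_periodic:
  assumes "\<And>\<epsilon> t. \<epsilon> \<in> {0..<\<epsilon>0} \<Longrightarrow> \<gamma> \<epsilon> (t + \<pi> \<epsilon>) = \<gamma> \<epsilon> t" "(\<pi> \<longlongrightarrow> P) (at_right 0)"
  shows "primitive (t + P) = primitive t"
proof -
  have "((\<lambda>\<epsilon>. (F (\<gamma> \<epsilon> (t + \<pi> \<epsilon>)) - F (\<gamma> \<epsilon> t)) / \<epsilon>) \<longlongrightarrow> primitive (t + P) - primitive t) (at_right 0)"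
    using assms(2) by (intro F_increment_quotient_tendsto tendsto_intros)
  moreover have "((\<lambda>\<epsilon>. (F (\<gamma> \<epsilon> (t + \<pi> \<epsilon>)) - F (\<gamma> \<epsilon> t)) / \<epsilon>) \<longlongrightarrow> 0) (at_right 0)"
    by (rule tendsto_eventually) (use eventually_parameter assms(1) in \<open>auto elim!: eventually_mono\<close>)
  ultimately show ?thesis using tendsto_unique[OF trivial_limit_at_right_real] by fastforce
qed

text \<open>
  The time \<open>s\<close> of the return need not be a multiple of \<open>P\<close>, since \<open>P\<close> need not be the minimal
  period. By uniqueness \<open>s\<close> is a period of the orbit, so the primitive gains the same amount over each time
  interval of length \<open>s\<close>; a periodic function is bounded, hence this amount is \<open>0\<close>.
\<close>

lemma primitive_return:
  assumes "P > 0" and periodic: "\<And>t. primitive (t + P) = primitive t"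
    and "\<gamma> 0 s = \<gamma> 0 0"
  shows "primitive s = primitive 0"
proof -
  have shift: "\<gamma> 0 (t + s) = \<gamma> 0 t" for t
    using unperturbed_curve_unique[OF integral_curve_shift[OF unperturbed_curve, of s] unperturbed_curve, of 0]
      assms(3) by (metis add_0)
  define c where "c = primitive s - primitive 0"
  have step: "primitive (t + s) = primitive t + c" for t
  proof -
    have "((\<lambda>t. primitive (t + s) - primitive t) has_vector_derivative 0) (at t within UNIV)" for t
    proof -
      have "((\<lambda>t. t + s) has_vector_derivative 1) (at t)" by (auto intro!: derivative_eq_intros)
      from vector_diff_chain_at[OF this primitive_derivative]
      have "((\<lambda>t. primitive (t + s)) has_vector_derivative melnikov t) (at t)"
        by (simp add: o_def shift)
      from has_vector_derivative_diff[OF this primitive_derivative[of t]] show ?thesis by simp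
    qed
    then obtain k where k: "\<And>t. t \<in> UNIV \<Longrightarrow> primitive (t + s) - primitive t = k"
      by (rule has_vector_derivative_zero_constant[OF convex_UNIV]) (rule that)
    from k[of t] k[of 0] show ?thesis by (simp add: c_def)
  qed
  have multiple: "primitive (of_nat n * s) = primitive 0 + of_nat n * c" for n :: nat
  proof (induction n)
    case (Suc n)
    have "of_nat (Suc n) * s = of_nat n * s + s" by (simp add: algebra_simps)
    then show ?case using step[of "of_nat n * s"] Suc by (simp add: algebra_simps)
  qed simp
  have "compact (primitive ` {0..P})"
    by (intro compact_continuous_image continuous_on_primitive compact_Icc)
  then obtain M where M: "\<And>t. t \<in> {0..P} \<Longrightarrow> \<bar>primitive t\<bar> \<le> M"
    by (force dest!: compact_imp_bounded simp: bounded_iff)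
  have bounded: "\<bar>primitive x\<bar> \<le> M" for x
    using M periodic_reduce[of primitive, OF periodic assms(1), of x] by force
  have "c = 0"
  proof (rule ccontr)
    assume "c \<noteq> 0"
    then obtain n :: nat where "2 * M + 1 < of_nat n * \<bar>c\<bar>"
      using ex_less_of_nat_mult[of "\<bar>c\<bar>" "2 * M + 1"] by auto
    moreover have "of_nat n * \<bar>c\<bar> = \<bar>of_nat n * c\<bar>" by (simp add: abs_mult)
    ultimately show False using bounded[of "of_nat n * s"] bounded[of 0] multiple[of n] by linarith
  qed
  then show ?thesis by (simp add: c_def)
qed

text \<open>
  Times at which the perturbed orbit is near the base point must be close to times at which the
  unperturbed orbit passes through it, and there the primitive is close to its value at \<open>0\<close>. The difference of
  \<open>F\<close> between two such points is \<open>\<epsilon>\<close> times the small difference of the primitive, up to \<open>o(\<epsilon>)\<close>.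
\<close>

lemma F_oscillation_near_base_point:
  assumes periodic: "\<And>\<epsilon> t. \<epsilon> \<in> {0..<\<epsilon>0} \<Longrightarrow> \<gamma> \<epsilon> (t + \<pi> \<epsilon>) = \<gamma> \<epsilon> t"
    and "(\<pi> \<longlongrightarrow> P) (at_right 0)" "P > 0" "\<eta> > 0"
  obtains N where "open N" "\<gamma> 0 0 \<in> N"
    "eventually (\<lambda>\<epsilon>. \<forall>y\<in>\<gamma> \<epsilon> ` {0..<\<pi> \<epsilon>} \<inter> N. \<forall>y'\<in>\<gamma> \<epsilon> ` {0..<\<pi> \<epsilon>} \<inter> N. \<bar>F y - F y'\<bar> \<le> \<epsilon> * \<eta>) (at_right 0)"
proof -
  \<comment> \<open>The times at which the primitive is not close to its value at \<open>0\<close>; the interval is longer than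
    \<open>P\<close> because the perturbed periods may exceed \<open>P\<close>.\<close>
  define K where "K = {s \<in> {0..P + 1}. \<eta> / 4 \<le> \<bar>primitive s - primitive 0\<bar>}"
  have "closed {s. \<eta> / 4 \<le> \<bar>primitive s - primitive 0\<bar>}"
    by (intro closed_Collect_le continuous_intros continuous_on_primitive)
  from compact_Int_closed[OF compact_Icc this, of 0 "P + 1"]
  have "compact K" by (simp add: K_def Int_def)
  \<comment> \<open>Taking the point together with \<open>\<epsilon>\<close> as the parameter of the compactness argument produces the
    neighbourhood \<open>N\<close> as well.\<close>
  have "eventually (\<lambda>z. \<forall>t\<in>K. \<gamma> (fst z) t \<noteq> snd z) (at_right 0 \<times>\<^sub>F nhds (\<gamma> 0 0))"
  proof (rule eventually_ball_compact[OF \<open>compact K\<close>])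
    fix t assume t: "t \<in> K"
    have "\<gamma> 0 t \<noteq> \<gamma> 0 0"
      using primitive_return[OF assms(3) primitive_periodic[OF assms(1,2)], of t] t assms(4)
      by (auto simp: K_def)
    from hausdorff[OF this] obtain V N
      where VN: "open V" "open N" "\<gamma> 0 t \<in> V" "\<gamma> 0 0 \<in> N" "V \<inter> N = {}"
      by (elim exE conjE)
    let ?G = "(at_right 0 \<times>\<^sub>F nhds (\<gamma> 0 0)) \<times>\<^sub>F nhds t"
    have "filterlim (\<lambda>w. (fst (fst w), snd w)) (at_right 0 \<times>\<^sub>F nhds t) ?G"
      by (intro filterlim_Pair filterlim_compose[OF filterlim_fst filterlim_fst] filterlim_snd)
    from filterlim_compose[OF curves_tendsto this]
    have "((\<lambda>w. \<gamma> (fst (fst w)) (snd w)) \<longlongrightarrow> \<gamma> 0 t) ?G" by simp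
    then have "eventually (\<lambda>w. \<gamma> (fst (fst w)) (snd w) \<in> V) ?G"
      using VN(1,3) by (rule topological_tendstoD)
    moreover have "((\<lambda>w. snd (fst w)) \<longlongrightarrow> \<gamma> 0 0) ?G"
      by (rule filterlim_compose[OF filterlim_snd filterlim_fst])
    then have "eventually (\<lambda>w. snd (fst w) \<in> N) ?G"
      using VN(2,4) by (rule topological_tendstoD)
    ultimately show "eventually (\<lambda>(z, t). \<gamma> (fst z) t \<noteq> snd z) ?G"
      by eventually_elim (use VN(5) in auto)
  qed
  then obtain Pf Pg where Pf: "eventually Pf (at_right 0)" and Pg: "eventually Pg (nhds (\<gamma> 0 0))"
    and *: "\<And>\<epsilon> q t. Pf \<epsilon> \<Longrightarrow> Pg q \<Longrightarrow> t \<in> K \<Longrightarrow> \<gamma> \<epsilon> t \<noteq> q"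
    unfolding eventually_prod_filter by auto
  from Pg obtain N where N: "open N" "\<gamma> 0 0 \<in> N" "\<And>q. q \<in> N \<Longrightarrow> Pg q"
    unfolding eventually_nhds by blast
  have "eventually (\<lambda>\<epsilon>. \<pi> \<epsilon> < P + 1) (at_right 0)"
    using assms(2) by (rule order_tendstoD) simp
  moreover have "\<eta> / 2 > 0" using assms(4) by simp
  note F_increment_uniform[OF this, of 0 "P + 1"]
  moreover note Pf eventually_parameter
  ultimately have "eventually (\<lambda>\<epsilon>. \<forall>y\<in>\<gamma> \<epsilon> ` {0..<\<pi> \<epsilon>} \<inter> N. \<forall>y'\<in>\<gamma> \<epsilon> ` {0..<\<pi> \<epsilon>} \<inter> N.
      \<bar>F y - F y'\<bar> \<le> \<epsilon> * \<eta>) (at_right 0)"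
  proof eventually_elim
    case (elim \<epsilon>)
    then have \<epsilon>: "\<epsilon> > 0" by simp
    have close: "\<bar>primitive s - primitive 0\<bar> < \<eta> / 4" "s \<in> {0..P + 1}"
      if "s \<in> {0..<\<pi> \<epsilon>}" "\<gamma> \<epsilon> s \<in> N" for s
    proof -
      show s: "s \<in> {0..P + 1}" using that elim(1) by auto
      have "s \<notin> K" using *[OF elim(3) N(3)[OF that(2)], of s] by blast
      with s show "\<bar>primitive s - primitive 0\<bar> < \<eta> / 4" by (auto simp: K_def)
    qed
    have "\<bar>F (\<gamma> \<epsilon> t) - F (\<gamma> \<epsilon> s)\<bar> \<le> \<epsilon> * \<eta>"
      if s: "s \<in> {0..<\<pi> \<epsilon>}" "\<gamma> \<epsilon> s \<in> N" and t: "t \<in> {0..<\<pi> \<epsilon>}" "\<gamma> \<epsilon> t \<in> N" for s t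
    proof -
      have "\<bar>primitive t - primitive s\<bar> \<le> \<eta> / 2" using close(1)[OF s] close(1)[OF t] by linarith
      then have "\<bar>\<epsilon> * (primitive t - primitive s)\<bar> \<le> \<epsilon> * (\<eta> / 2)"
        using \<epsilon> by (simp add: abs_mult)
      moreover have "\<bar>F (\<gamma> \<epsilon> t) - F (\<gamma> \<epsilon> s) - \<epsilon> * (primitive t - primitive s)\<bar> \<le> \<epsilon> * (\<eta> / 2)"
        using elim(2) close(2)[OF s] close(2)[OF t] by blast
      moreover have "\<epsilon> * (\<eta> / 2) + \<epsilon> * (\<eta> / 2) = \<epsilon> * \<eta>" by (simp add: algebra_simps)
      ultimately show ?thesis by linarith
    qed
    then show ?case by blast
  qed
  with N show thesis using that by blast
qed

section \<open>The homoclinic orbit\<close>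

text \<open>
  For each time \<open>s\<close> the quotient \<open>(F (\<gamma> \<epsilon> (\<tau> \<epsilon> s)) - F (\<gamma> 0 s)) / \<epsilon>\<close> stays within \<open>\<eta> / 4\<close> of a number \<open>g s\<close>, for
  all \<open>\<epsilon>\<close> in a range independent of \<open>s\<close>. As \<open>\<epsilon>\<close> tends to \<open>0\<close> the difference of two such quotients tends to
  the increment of the primitive, which is therefore close to \<open>g s - g s'\<close>. The perturbed
  points stay in the closed subset \<open>K\<close> of \<open>N\<close>, which keeps their limit points in \<open>N\<close>.
\<close>

lemma F_increment_uniform_in_time:
  assumes bounds: "uniform_C2_bounds A \<epsilon>0 (\<lambda>\<epsilon> s. \<gamma> \<epsilon> (\<tau> \<epsilon> s))"
    and \<tau>_zero: "\<And>s. \<tau> 0 s = s" and \<tau>_lim: "\<And>s. ((\<lambda>\<epsilon>. \<tau> \<epsilon> s) \<longlongrightarrow> s) (at_right 0)"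
    and p: "p \<in> W" and N: "open N" "p \<in> N" and "\<eta> > 0"
  obtains V K where "open V" "p \<in> V" "closed K" "K \<subseteq> W \<inter> N"
    "eventually (\<lambda>\<epsilon>. \<forall>s s'. \<gamma> 0 s \<in> V \<longrightarrow> \<gamma> 0 s' \<in> V \<longrightarrow> \<gamma> \<epsilon> (\<tau> \<epsilon> s) \<in> K \<and>
       \<bar>F (\<gamma> \<epsilon> (\<tau> \<epsilon> s)) - F (\<gamma> \<epsilon> (\<tau> \<epsilon> s')) - \<epsilon> * (primitive s - primitive s')\<bar> \<le> \<epsilon> * \<eta>) (at_right 0)"
proof -
  let ?\<Phi> = "\<lambda>\<epsilon> s. \<gamma> \<epsilon> (\<tau> \<epsilon> s)"
  obtain c where c: "c \<in> A" "p \<in> fst c" by (rule chart_around[OF manifold])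
  note inv = chart_inv_chart[OF manifold c(1)]
  let ?f = "F \<circ> chart_inv c" and ?u = "snd c p" and ?U = "snd c ` (fst c \<inter> (W \<inter> N))"
  have "open ?U" "?u \<in> ?U"
    using open_chart_image_Int[OF manifold c(1) open_Int[OF open_W N(1)]] c p N by auto
  then obtain q where q: "q > 0" "cball ?u q \<subseteq> ?U" using open_contains_cball by blast
  have in_chart: "chart_inv c x \<in> fst c \<inter> (W \<inter> N)" if "x \<in> cball ?u q" for x
    using that q(2) inv by fastforce
  have image_compact: "compact (chart_inv c ` cball ?u r)" if "r \<le> q" for r
  proof (rule compact_continuous_image[OF continuous_on_subset[OF continuous_on_chart_inv[OF manifold c(1)]]])
    have "cball ?u r \<subseteq> cball ?u q" using that by auto
    then show "cball ?u r \<subseteq> snd c ` fst c" using q(2) by blast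
  qed simp
  obtain \<delta>1 B where \<delta>1: "0 < \<delta>1" "\<delta>1 \<le> \<epsilon>0" and B: "\<And>s. ?\<Phi> 0 s \<in> chart_inv c ` cball ?u q \<Longrightarrow>
      \<exists>D1 D2. \<forall>\<epsilon>\<in>{0..<\<delta>1}. ?\<Phi> \<epsilon> s \<in> fst c \<and>
         ((\<lambda>e. snd c (?\<Phi> e s)) has_vector_derivative D1 \<epsilon>) (at \<epsilon> within {0..<\<delta>1}) \<and>
         (D1 has_vector_derivative D2 \<epsilon>) (at \<epsilon> within {0..<\<delta>1}) \<and>
         norm (D1 \<epsilon>) \<le> B \<and> norm (D2 \<epsilon>) \<le> B"
    using bounds[unfolded uniform_C2_bounds_def, rule_format, OF c(1), of "chart_inv c ` cball ?u q"]
      image_compact[of q] in_chart by blast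
  have sub: "ball ?u q \<subseteq> snd c ` (fst c \<inter> W)"
    using q(2) ball_subset_cball by blast
  have f: "\<And>x. x \<in> ball ?u q \<Longrightarrow> (?f has_derivative frechet_derivative ?f (at x)) (at x)"
    "\<And>v. continuous_on (ball ?u q) (\<lambda>x. frechet_derivative ?f (at x) v)"
    using Ck_function_chart_derivative[OF manifold F_Suc open_W c(1)] sub continuous_on_subset by blast+
  \<comment> \<open>The bound \<open>B\<close> need not be positive.\<close>
  have u0: "?u \<in> ball ?u q" and "\<eta> / 4 > 0" "max B 1 > 0" using q(1) assms(7) by auto
  obtain \<rho> \<delta> where \<rho>: "\<rho> > 0" "\<delta> > 0" "cball ?u \<rho> \<subseteq> ball ?u q" and
    exp: "\<And>u D1 D2 d e. u 0 \<in> cball ?u (\<rho> / 2) \<Longrightarrow>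
       \<forall>x\<in>{0..<d}. (u has_vector_derivative D1 x) (at x within {0..<d}) \<and>
          (D1 has_vector_derivative D2 x) (at x within {0..<d}) \<and>
          norm (D1 x) \<le> max B 1 \<and> norm (D2 x) \<le> max B 1 \<Longrightarrow>
       0 < e \<Longrightarrow> e < d \<Longrightarrow> e < \<delta> \<Longrightarrow>
       u e \<in> cball ?u \<rho> \<and> \<bar>?f (u e) - ?f (u 0) - e * frechet_derivative ?f (at (u 0)) (D1 0)\<bar> \<le> e * (\<eta> / 4)"
    by (rule uniform_first_order_expansion[OF open_ball u0 \<open>\<eta> / 4 > 0\<close> \<open>max B 1 > 0\<close> f]) (assumption, rule that)
  define K where "K = chart_inv c ` cball ?u \<rho>"
  define V where "V = snd c -` ball ?u (\<rho> / 2) \<inter> fst c"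
  have cb: "cball ?u \<rho> \<subseteq> cball ?u q" using \<rho>(3) ball_subset_cball by blast
  then have "\<rho> \<le> q" using \<rho>(1) by (simp add: cball_subset_cball_iff)
  define d where "d = min \<delta>1 \<delta>"
  have d: "d > 0" using \<delta>1 \<rho>(2) by (simp add: d_def)
  have "\<exists>g. \<forall>e\<in>{0<..<d}. ?\<Phi> e s \<in> K \<and> \<bar>F (?\<Phi> e s) - F (\<gamma> 0 s) - e * g\<bar> \<le> e * (\<eta> / 4)"
    if s: "\<gamma> 0 s \<in> V" for s
  proof -
    have us: "snd c (\<gamma> 0 s) \<in> ball ?u (\<rho> / 2)" "\<gamma> 0 s \<in> fst c" using s by (auto simp: V_def)
    then have "snd c (\<gamma> 0 s) \<in> cball ?u q" using cb \<rho>(1) by (auto simp: subset_iff)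
    then have "?\<Phi> 0 s \<in> chart_inv c ` cball ?u q"
      using inv[OF us(2)] by (metis \<tau>_zero image_eqI)
    from B[OF this] obtain D1 D2 where D: "\<And>e. e \<in> {0..<\<delta>1} \<Longrightarrow> ?\<Phi> e s \<in> fst c \<and>
         ((\<lambda>e. snd c (?\<Phi> e s)) has_vector_derivative D1 e) (at e within {0..<\<delta>1}) \<and>
         (D1 has_vector_derivative D2 e) (at e within {0..<\<delta>1}) \<and>
         norm (D1 e) \<le> B \<and> norm (D2 e) \<le> B" by blast
    let ?v = "\<lambda>e. snd c (?\<Phi> e s)"
    have "?\<Phi> e s \<in> K \<and>
        \<bar>F (?\<Phi> e s) - F (\<gamma> 0 s) - e * frechet_derivative ?f (at (?v 0)) (D1 0)\<bar> \<le> e * (\<eta> / 4)"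
      if e: "e \<in> {0<..<d}" for e
    proof -
      have e': "0 < e" "e < \<delta>1" "e < \<delta>" "e \<in> {0..<\<delta>1}" using e by (auto simp: d_def)
      have "?v e \<in> cball ?u \<rho> \<and>
          \<bar>?f (?v e) - ?f (?v 0) - e * frechet_derivative ?f (at (?v 0)) (D1 0)\<bar> \<le> e * (\<eta> / 4)"
        by (rule exp[of ?v \<delta>1 D1 D2, OF _ _ e'(1-3)]) (use D us \<tau>_zero in \<open>auto simp: max.coboundedI1\<close>)
      moreover have "chart_inv c (?v e) = ?\<Phi> e s" using D[OF e'(4)] inv by blast
      moreover have "chart_inv c (?v 0) = \<gamma> 0 s" using inv[OF us(2)] \<tau>_zero by simp
      ultimately show ?thesis unfolding K_def o_apply by (metis image_eqI)
    qed
    then show ?thesis by blast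
  qed
  then have "\<forall>s\<in>{s. \<gamma> 0 s \<in> V}. \<exists>g. \<forall>e\<in>{0<..<d}. ?\<Phi> e s \<in> K \<and>
      \<bar>F (?\<Phi> e s) - F (\<gamma> 0 s) - e * g\<bar> \<le> e * (\<eta> / 4)" by simp
  from bchoice[OF this] obtain g where "\<forall>s\<in>{s. \<gamma> 0 s \<in> V}. \<forall>e\<in>{0<..<d}. ?\<Phi> e s \<in> K \<and>
      \<bar>F (?\<Phi> e s) - F (\<gamma> 0 s) - e * g s\<bar> \<le> e * (\<eta> / 4)" ..
  then have g: "\<And>s e. \<gamma> 0 s \<in> V \<Longrightarrow> e \<in> {0<..<d} \<Longrightarrow> ?\<Phi> e s \<in> K"
    "\<And>s e. \<gamma> 0 s \<in> V \<Longrightarrow> e \<in> {0<..<d} \<Longrightarrow> \<bar>F (?\<Phi> e s) - F (\<gamma> 0 s) - e * g s\<bar> \<le> e * (\<eta> / 4)"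
    by blast+
  have main: "\<bar>F (?\<Phi> \<epsilon> s) - F (?\<Phi> \<epsilon> s') - \<epsilon> * (primitive s - primitive s')\<bar> \<le> \<epsilon> * \<eta>"
    if s: "\<gamma> 0 s \<in> V" "\<gamma> 0 s' \<in> V" and \<epsilon>: "\<epsilon> \<in> {0<..<d}" for s s' \<epsilon>
  proof -
    let ?q = "\<lambda>e. (F (?\<Phi> e s) - F (?\<Phi> e s')) / e" and ?G = "g s - g s'"
    have qG: "\<bar>?q e - ?G\<bar> \<le> \<eta> / 2" if e: "e \<in> {0<..<d}" for e
    proof -
      have "e * ?G = e * g s - e * g s'" "e * (\<eta> / 2) = e * (\<eta> / 4) + e * (\<eta> / 4)"
        by (simp_all add: algebra_simps)
      then have "\<bar>F (?\<Phi> e s) - F (?\<Phi> e s') - e * ?G\<bar> \<le> e * (\<eta> / 2)"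
        using g(2)[OF s(1) e] g(2)[OF s(2) e] F_conserved[of s s'] by linarith
      moreover have "?q e - ?G = (F (?\<Phi> e s) - F (?\<Phi> e s') - e * ?G) / e"
        using e by (simp add: field_simps)
      ultimately show ?thesis using e by (simp add: abs_divide divide_le_eq mult.commute)
    qed
    have "((\<lambda>e. \<bar>?q e - ?G\<bar>) \<longlongrightarrow> \<bar>primitive s - primitive s' - ?G\<bar>) (at_right 0)"
      by (intro tendsto_intros F_increment_quotient_tendsto \<tau>_lim)
    moreover have "eventually (\<lambda>e. \<bar>?q e - ?G\<bar> \<le> \<eta> / 2) (at_right 0)"
      using eventually_at_right_real[OF d] by (rule eventually_mono) (rule qG)
    ultimately have "\<bar>primitive s - primitive s' - ?G\<bar> \<le> \<eta> / 2"
      by (rule tendsto_upperbound) simp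
    with qG[OF \<epsilon>] have "\<bar>?q \<epsilon> - (primitive s - primitive s')\<bar> \<le> \<eta>" by linarith
    moreover have "F (?\<Phi> \<epsilon> s) - F (?\<Phi> \<epsilon> s') - \<epsilon> * (primitive s - primitive s') =
        \<epsilon> * (?q \<epsilon> - (primitive s - primitive s'))" using \<epsilon> by (simp add: field_simps)
    ultimately show ?thesis using \<epsilon> by (simp add: abs_mult)
  qed
  show thesis
  proof (rule that[of V K])
    show "open V"
      unfolding V_def using continuous_on_chart[OF manifold c(1)] open_chart_domain[OF manifold c(1)]
      by (simp add: continuous_on_open_vimage)
    show "p \<in> V" using c \<rho>(1) by (simp add: V_def)
    show "closed K" unfolding K_def by (rule compact_imp_closed[OF image_compact[OF \<open>\<rho> \<le> q\<close>]])
    show "K \<subseteq> W \<inter> N" using in_chart cb by (auto simp: K_def subset_iff)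
    show "eventually (\<lambda>\<epsilon>. \<forall>s s'. \<gamma> 0 s \<in> V \<longrightarrow> \<gamma> 0 s' \<in> V \<longrightarrow> \<gamma> \<epsilon> (\<tau> \<epsilon> s) \<in> K \<and>
       \<bar>F (\<gamma> \<epsilon> (\<tau> \<epsilon> s)) - F (\<gamma> \<epsilon> (\<tau> \<epsilon> s')) - \<epsilon> * (primitive s - primitive s')\<bar> \<le> \<epsilon> * \<eta>) (at_right 0)"
      using eventually_at_right_real[OF d] by (rule eventually_mono) (use g(1) main in blast)
  qed
qed

text \<open>
  The curve \<open>x\<close> need not converge, so its value of \<open>F\<close> is compared with a point of the limit set that
  depends on the time. That \<open>K\<close> is closed ensures that this point can be found in \<open>N\<close>.
\<close>

lemma F_near_limit_set:
  assumes "closed K" "K \<subseteq> W \<inter> N" "\<mu> > 0"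
    and limit: "\<And>V. open V \<Longrightarrow> \<Gamma> \<subseteq> V \<Longrightarrow> eventually (\<lambda>t. x t \<in> V) G"
  shows "eventually (\<lambda>t. x t \<in> K \<longrightarrow> (\<exists>y\<in>\<Gamma> \<inter> N. \<bar>F (x t) - F y\<bar> < \<mu>)) G"
proof -
  let ?O = "\<lambda>y. W \<inter> F -` {F y - \<mu><..<F y + \<mu>}"
  have "open (?O y)" for y
    using continuous_on_F open_W by (metis Int_commute continuous_on_open_vimage open_greaterThanLessThan)
  then have "open (- K \<union> (\<Union>y\<in>\<Gamma> \<inter> N. ?O y))" using assms(1) by (intro open_Un open_UN) auto
  moreover have "\<Gamma> \<subseteq> - K \<union> (\<Union>y\<in>\<Gamma> \<inter> N. ?O y)" using assms(2,3) by auto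
  ultimately have "eventually (\<lambda>t. x t \<in> - K \<union> (\<Union>y\<in>\<Gamma> \<inter> N. ?O y)) G" by (rule limit)
  then show ?thesis by (rule eventually_mono) (force simp: abs_less_iff)
qed

text \<open>
  The parameter \<open>\<epsilon>\<close> is fixed before \<open>k\<close> tends to infinity: this is possible since both the expansion
  of the increment and the oscillation bound hold for one \<open>\<epsilon>\<close> at all relevant times.
\<close>

lemma primitive_increment_tendsto_0:
  fixes a b :: "nat \<Rightarrow> real"
  assumes bounds: "uniform_C2_bounds A \<epsilon>0 (\<lambda>\<epsilon> s. \<gamma> \<epsilon> (\<tau> \<epsilon> s))"
    and \<tau>_zero: "\<And>s. \<tau> 0 s = s" and \<tau>_lim: "\<And>s. ((\<lambda>\<epsilon>. \<tau> \<epsilon> s) \<longlongrightarrow> s) (at_right 0)"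
    and \<tau>_mono: "\<And>\<epsilon>. \<epsilon> \<in> {0..<\<epsilon>0} \<Longrightarrow> strict_mono (\<tau> \<epsilon>) \<and> surj (\<tau> \<epsilon>)"
    and limit: "\<And>\<epsilon> V. \<epsilon> \<in> {0..<\<epsilon>0} \<Longrightarrow> open V \<Longrightarrow> \<Gamma> \<epsilon> \<subseteq> V \<Longrightarrow>
          eventually (\<lambda>t. \<gamma> \<epsilon> t \<in> V) at_top \<and> eventually (\<lambda>t. \<gamma> \<epsilon> t \<in> V) at_bot"
    and p: "p \<in> W"
    and osc: "\<And>\<eta>. \<eta> > 0 \<Longrightarrow> \<exists>N. open N \<and> p \<in> N \<and>
          eventually (\<lambda>\<epsilon>. \<forall>y\<in>\<Gamma> \<epsilon> \<inter> N. \<forall>y'\<in>\<Gamma> \<epsilon> \<inter> N. \<bar>F y - F y'\<bar> \<le> \<epsilon> * \<eta>) (at_right 0)"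
    and a: "filterlim a at_bot sequentially" "((\<lambda>k. \<gamma> 0 (a k)) \<longlongrightarrow> p) sequentially"
    and b: "filterlim b at_top sequentially" "((\<lambda>k. \<gamma> 0 (b k)) \<longlongrightarrow> p) sequentially"
  shows "(\<lambda>k. primitive (b k) - primitive (a k)) \<longlonglongrightarrow> 0"
proof (rule tendstoI)
  fix r :: real assume "r > 0"
  \<comment> \<open>Four errors of size \<open>\<epsilon> \<eta>\<close> add up: two from approaching the limit set, one from the
    oscillation on it and one from the expansion of the increment.\<close>
  define \<eta> where "\<eta> = r / 5"
  have \<eta>: "\<eta> > 0" using \<open>r > 0\<close> by (simp add: \<eta>_def)
  obtain N where N: "open N" "p \<in> N" and N_osc: "eventually (\<lambda>\<epsilon>. \<forall>y\<in>\<Gamma> \<epsilon> \<inter> N. \<forall>y'\<in>\<Gamma> \<epsilon> \<inter> N.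
      \<bar>F y - F y'\<bar> \<le> \<epsilon> * \<eta>) (at_right 0)"
    using osc[OF \<eta>] by blast
  obtain V K where V: "open V" "p \<in> V" and K: "closed K" "K \<subseteq> W \<inter> N"
    and unif: "eventually (\<lambda>\<epsilon>. \<forall>s s'. \<gamma> 0 s \<in> V \<longrightarrow> \<gamma> 0 s' \<in> V \<longrightarrow> \<gamma> \<epsilon> (\<tau> \<epsilon> s) \<in> K \<and>
       \<bar>F (\<gamma> \<epsilon> (\<tau> \<epsilon> s)) - F (\<gamma> \<epsilon> (\<tau> \<epsilon> s')) - \<epsilon> * (primitive s - primitive s')\<bar> \<le> \<epsilon> * \<eta>) (at_right 0)"
    by (rule F_increment_uniform_in_time[OF bounds \<tau>_zero \<tau>_lim p N \<eta>]) (rule that)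
  from eventually_happens'[OF trivial_limit_at_right_real
      eventually_conj[OF eventually_parameter eventually_conj[OF N_osc unif]]]
  obtain \<epsilon> where \<epsilon>: "0 < \<epsilon>" "\<epsilon> \<in> {0..<\<epsilon>0}"
    and osc_\<epsilon>: "\<And>y y'. y \<in> \<Gamma> \<epsilon> \<inter> N \<Longrightarrow> y' \<in> \<Gamma> \<epsilon> \<inter> N \<Longrightarrow> \<bar>F y - F y'\<bar> \<le> \<epsilon> * \<eta>"
    and in_K: "\<And>s. \<gamma> 0 s \<in> V \<Longrightarrow> \<gamma> \<epsilon> (\<tau> \<epsilon> s) \<in> K"
    and inc: "\<And>s s'. \<gamma> 0 s \<in> V \<Longrightarrow> \<gamma> 0 s' \<in> V \<Longrightarrow>
       \<bar>F (\<gamma> \<epsilon> (\<tau> \<epsilon> s)) - F (\<gamma> \<epsilon> (\<tau> \<epsilon> s')) - \<epsilon> * (primitive s - primitive s')\<bar> \<le> \<epsilon> * \<eta>"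
    by (auto simp: less_imp_le)
  have mono: "mono (\<tau> \<epsilon>)" and surj: "surj (\<tau> \<epsilon>)"
    using \<tau>_mono[OF \<epsilon>(2)] strict_mono_mono by blast+
  have "filterlim (\<tau> \<epsilon>) at_top at_top"
    unfolding filterlim_at_top eventually_at_top_linorder using mono surj by (metis monoD surjD)
  then have b': "filterlim (\<lambda>k. \<tau> \<epsilon> (b k)) at_top sequentially" using b(1) by (rule filterlim_compose)
  have "filterlim (\<tau> \<epsilon>) at_bot at_bot"
    unfolding filterlim_at_bot eventually_at_bot_linorder using mono surj by (metis monoD surjD)
  then have a': "filterlim (\<lambda>k. \<tau> \<epsilon> (a k)) at_bot sequentially" using a(1) by (rule filterlim_compose)
  have pos: "\<epsilon> * \<eta> > 0" using \<epsilon>(1) \<eta> by simp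
  have tail: "eventually (\<lambda>k. \<gamma> \<epsilon> (c k) \<in> K \<longrightarrow> (\<exists>y\<in>\<Gamma> \<epsilon> \<inter> N. \<bar>F (\<gamma> \<epsilon> (c k)) - F y\<bar> < \<epsilon> * \<eta>)) sequentially"
    if "filterlim c at_top sequentially \<or> filterlim c at_bot sequentially" for c
  proof (rule F_near_limit_set[OF K pos])
    fix V assume "open V" "\<Gamma> \<epsilon> \<subseteq> V"
    from limit[OF \<epsilon>(2) this] that show "eventually (\<lambda>k. \<gamma> \<epsilon> (c k) \<in> V) sequentially"
      by (auto intro: eventually_compose_filterlim[where P = "\<lambda>t. \<gamma> \<epsilon> t \<in> V"])
  qed
  have "eventually (\<lambda>k. \<gamma> 0 (a k) \<in> V) sequentially" "eventually (\<lambda>k. \<gamma> 0 (b k) \<in> V) sequentially"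
    using a(2) b(2) V by (auto dest: topological_tendstoD)
  moreover note tail[OF disjI1[OF b']] tail[OF disjI2[OF a']]
  ultimately show "eventually (\<lambda>k. dist (primitive (b k) - primitive (a k)) 0 < r) sequentially"
  proof eventually_elim
    case (elim k)
    let ?Fa = "F (\<gamma> \<epsilon> (\<tau> \<epsilon> (a k)))" and ?Fb = "F (\<gamma> \<epsilon> (\<tau> \<epsilon> (b k)))"
    obtain y y' where y: "y \<in> \<Gamma> \<epsilon> \<inter> N" "\<bar>?Fb - F y\<bar> < \<epsilon> * \<eta>" and y': "y' \<in> \<Gamma> \<epsilon> \<inter> N" "\<bar>?Fa - F y'\<bar> < \<epsilon> * \<eta>"
      using elim in_K by blast
    from osc_\<epsilon>[OF y(1) y'(1)] y(2) y'(2) inc[OF elim(2,1)]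
    have "\<bar>\<epsilon> * (primitive (b k) - primitive (a k))\<bar> < \<epsilon> * \<eta> + \<epsilon> * \<eta> + \<epsilon> * \<eta> + \<epsilon> * \<eta>" by linarith
    also have "\<dots> < \<epsilon> * r" using \<epsilon>(1) \<open>r > 0\<close> by (simp add: \<eta>_def)
    finally have "\<epsilon> * \<bar>primitive (b k) - primitive (a k)\<bar> < \<epsilon> * r" using \<epsilon>(1) by (simp add: abs_mult)
    then show ?case using \<epsilon>(1) by (simp add: dist_real_def)
  qed
qed

end

theorem theorem2p3:
  fixes A :: "('m::t2_space, 'n::finite) chart set"
    and X :: "real \<Rightarrow> ('m, 'n) field" and X0 X1 :: "('m, 'n) field"
    and \<epsilon>0 P :: real and period :: "real \<Rightarrow> real"
    and \<gamma>p \<gamma>h :: "real \<Rightarrow> 'm" and \<gamma>p\<epsilon> \<gamma>h\<epsilon> :: "real \<Rightarrow> real \<Rightarrow> 'm"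
    and F :: "'m \<Rightarrow> real" and W :: "'m set" and T :: "int \<Rightarrow> real"
  assumes "oriented_C3_manifold A" and "CARD('n) \<ge> 2"
    and "\<epsilon>0 > 0" and "C2_field_family A \<epsilon>0 X" and "first_order_expansion A X X0 X1"
    and "periodic_orbit A X0 P \<gamma>p"
    and "homoclinic_orbit A X0 \<gamma>h (\<gamma>p ` {0..<P})"
    and "open W" and "range \<gamma>h \<union> \<gamma>p ` {0..<P} \<subseteq> W"
    and "Ck_function A 3 W F" and "first_integral_on A X0 W F" and "\<not> F constant_on W"
    and "\<And>\<epsilon>. \<epsilon> \<in> {0..<\<epsilon>0} \<Longrightarrow> periodic_orbit A (X \<epsilon>) (period \<epsilon>) (\<gamma>p\<epsilon> \<epsilon>)"
    and "C2_periodic_family A \<epsilon>0 period \<gamma>p\<epsilon>"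
    and "\<gamma>p\<epsilon> 0 = \<gamma>p" and "period 0 = P"
    and "\<And>\<epsilon>. equilibrium_orbit \<gamma>p \<Longrightarrow> \<epsilon> \<in> {0..<\<epsilon>0} \<Longrightarrow> equilibrium_orbit (\<gamma>p\<epsilon> \<epsilon>)"
    and "\<And>\<epsilon>. \<epsilon> \<in> {0..<\<epsilon>0} \<Longrightarrow>
           homoclinic_orbit A (X \<epsilon>) (\<gamma>h\<epsilon> \<epsilon>) (\<gamma>p\<epsilon> \<epsilon> ` {0..<period \<epsilon>})"
    and "C2_homoclinic_family A \<epsilon>0 \<gamma>h\<epsilon>"
    and "\<gamma>h\<epsilon> 0 = \<gamma>h"
    and "time_sequence A X0 \<gamma>p \<gamma>h T"
  shows "(\<forall>k::nat. (\<lambda>t. d_along A F X1 (\<gamma>h t)) integrable_on {T (- int k)..T (int k)}) \<and>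
         (\<lambda>k::nat. integral {T (- int k)..T (int k)} (\<lambda>t. d_along A F X1 (\<gamma>h t)))
           \<longlonglongrightarrow> 0"
proof -
  have P: "P > 0" and \<gamma>p_periodic: "\<And>t. \<gamma>p (t + P) = \<gamma>p t"
    using assms(6) unfolding periodic_orbit_def by auto
  have \<gamma>p_range: "\<gamma>p t \<in> \<gamma>p ` {0..<P}" for t
    using periodic_reduce[of \<gamma>p, OF \<gamma>p_periodic P, of t] by auto
  interpret perturbed_first_integral A X X0 X1 \<epsilon>0 F W
    by unfold_locales (use assms in auto)
  interpret hom: perturbed_curves A X X0 X1 \<epsilon>0 F W \<gamma>h\<epsilon>
    by unfold_locales
      (use assms(7,9,18,19,20) in \<open>auto simp: C2_homoclinic_family_def C2_curve_family_def Ck_into_def homoclinic_orbit_def\<close>)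
  interpret per: perturbed_curves A X X0 X1 \<epsilon>0 F W \<gamma>p\<epsilon>
    by unfold_locales
      (use assms(6,9,13,14,15) \<gamma>p_range in
        \<open>auto simp: C2_periodic_family_def C2_curve_family_def Ck_into_def periodic_orbit_def\<close>)
  obtain \<tau> where \<tau>: "Ck_on 2 (\<lambda>(\<epsilon>, s). \<tau> \<epsilon> s :: real) ({0..<\<epsilon>0} \<times> UNIV)" "\<And>s. \<tau> 0 s = s"
    "\<And>\<epsilon>. \<epsilon> \<in> {0..<\<epsilon>0} \<Longrightarrow> strict_mono (\<tau> \<epsilon>) \<and> surj (\<tau> \<epsilon>)"
    "uniform_C2_bounds A \<epsilon>0 (\<lambda>\<epsilon> s. \<gamma>h\<epsilon> \<epsilon> (\<tau> \<epsilon> s))"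
    using assms(19) unfolding C2_homoclinic_family_def by blast
  have \<tau>_lim: "((\<lambda>\<epsilon>. \<tau> \<epsilon> s) \<longlongrightarrow> s) (at_right 0)" for s
  proof -
    have "continuous_on {0..<\<epsilon>0} (\<lambda>\<epsilon>. case (\<epsilon>, s) of (\<epsilon>, s) \<Rightarrow> \<tau> \<epsilon> s)"
      by (rule continuous_on_compose2[OF Ck_on_imp_continuous_on[OF \<tau>(1)]])
        (auto intro!: continuous_intros)
    then have "((\<lambda>\<epsilon>. \<tau> \<epsilon> s) \<longlongrightarrow> \<tau> 0 s) (at 0 within {0..<\<epsilon>0})"
      using assms(3) unfolding continuous_on_def by auto
    then show ?thesis using \<tau>(2) tendsto_at_right_within[OF assms(3)] by auto
  qed
  have period_lim: "(period \<longlongrightarrow> P) (at_right 0)"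
  proof -
    have "continuous_on {0..<\<epsilon>0} period"
      using assms(14) Ck_on_imp_continuous_on unfolding C2_periodic_family_def by blast
    then have "(period \<longlongrightarrow> period 0) (at 0 within {0..<\<epsilon>0})"
      using assms(3) unfolding continuous_on_def by auto
    then show ?thesis using assms(16) tendsto_at_right_within[OF assms(3)] by auto
  qed
  have T: "strict_mono T" "filterlim T at_top at_top" "filterlim T at_bot at_bot"
    using assms(21) unfolding time_sequence_def by auto
  have base: "((\<lambda>j. \<gamma>h (T j)) \<longlongrightarrow> \<gamma>p 0) at_top \<and> ((\<lambda>j. \<gamma>h (T j)) \<longlongrightarrow> \<gamma>p 0) at_bot"
  proof (cases "equilibrium_orbit \<gamma>p")
    case True
    then have "\<gamma>p ` {0..<P} = {\<gamma>p 0}"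
      using P unfolding equilibrium_orbit_def by (auto simp: image_iff)
    then have "(\<gamma>h \<longlongrightarrow> \<gamma>p 0) at_top" "(\<gamma>h \<longlongrightarrow> \<gamma>p 0) at_bot"
      using assms(7) unfolding homoclinic_orbit_def tendsto_def by auto
    then show ?thesis using T(2,3) by (auto intro: filterlim_compose)
  next
    case False
    then show ?thesis using assms(21) unfolding time_sequence_def by auto
  qed
  have pos: "filterlim (\<lambda>k. int k) at_top sequentially" by (rule filterlim_int_sequentially)
  have neg: "filterlim (\<lambda>k. - int k) at_bot sequentially"
    unfolding filterlim_at_bot eventually_sequentially
  proof
    fix Z
    show "\<exists>N. \<forall>n\<ge>N. - int n \<le> Z" by (rule exI[of _ "nat (- Z)"]) auto
  qed
  have "(\<lambda>k. hom.primitive (T (int k)) - hom.primitive (T (- int k))) \<longlonglongrightarrow> 0"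
  proof (rule hom.primitive_increment_tendsto_0[OF \<tau>(4,2) \<tau>_lim \<tau>(3)])
    fix \<epsilon> V assume "\<epsilon> \<in> {0..<\<epsilon>0}" "open V" "\<gamma>p\<epsilon> \<epsilon> ` {0..<period \<epsilon>} \<subseteq> V"
    with assms(18) show "eventually (\<lambda>t. \<gamma>h\<epsilon> \<epsilon> t \<in> V) at_top \<and> eventually (\<lambda>t. \<gamma>h\<epsilon> \<epsilon> t \<in> V) at_bot"
      unfolding homoclinic_orbit_def by blast
  next
    show "\<gamma>p 0 \<in> W" using per.in_W[of 0] assms(15) by simp
  next
    fix \<eta> :: real assume "\<eta> > 0"
    have periodic: "\<gamma>p\<epsilon> \<epsilon> (t + period \<epsilon>) = \<gamma>p\<epsilon> \<epsilon> t" if "\<epsilon> \<in> {0..<\<epsilon>0}" for \<epsilon> t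
      using assms(13)[OF that] unfolding periodic_orbit_def by blast
    show "\<exists>N. open N \<and> \<gamma>p 0 \<in> N \<and> eventually (\<lambda>\<epsilon>. \<forall>y\<in>\<gamma>p\<epsilon> \<epsilon> ` {0..<period \<epsilon>} \<inter> N.
        \<forall>y'\<in>\<gamma>p\<epsilon> \<epsilon> ` {0..<period \<epsilon>} \<inter> N. \<bar>F y - F y'\<bar> \<le> \<epsilon> * \<eta>) (at_right 0)"
      by (rule per.F_oscillation_near_base_point[OF periodic period_lim P \<open>\<eta> > 0\<close>]) (use assms(15) in auto)
  next
    show "filterlim (\<lambda>k. T (int k)) at_top sequentially" "filterlim (\<lambda>k. T (- int k)) at_bot sequentially"
      using filterlim_compose[OF T(2) pos] filterlim_compose[OF T(3) neg] by auto
    show "(\<lambda>k. \<gamma>h\<epsilon> 0 (T (int k))) \<longlonglongrightarrow> \<gamma>p 0" "(\<lambda>k. \<gamma>h\<epsilon> 0 (T (- int k))) \<longlonglongrightarrow> \<gamma>p 0"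
      using filterlim_compose[OF conjunct1[OF base] pos] filterlim_compose[OF conjunct2[OF base] neg]
        assms(20) by auto
  qed
  moreover have "((\<lambda>t. d_along A F X1 (\<gamma>h t)) has_integral
      hom.primitive (T (int k)) - hom.primitive (T (- int k))) {T (- int k)..T (int k)}" for k
    using hom.melnikov_has_integral[of "T (- int k)" "T (int k)"] T(1) assms(20)
    by (simp add: strict_mono_less_eq)
  ultimately show ?thesis
    by (metis (no_types, lifting) ext has_integral_integrable integral_unique)
qed

end
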